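(* Let $p>1$ be an integer and $c\in\mathbb{C}$. Suppose that there exists a nonzero generalized monomial $f\colon\mathbb{C}\to\mathbb{C}$ of degree $p$ satisfying $$\sum_{i=1}^n a_i f(\alpha_i x+\beta_i y)=c\cdot\sum_{l=0}^p x^l y^{p-l}\qquad (x,y\in\mathbb{C}).$$ Then there exist a finitely generated subfield $K\subset\mathbb{C}$ containing $\alpha_i$ and $\beta_i$ $(i=1,\ldots,n)$, an exponential $\phi$ in $S_p^*$, and automorphisms $\phi_1,\ldots,\phi_p\colon\mathbb{C}\to\mathbb{C}$ which are extensions of the functions in the decomposition formula of $\phi$ (that is, $\phi_j(x)=\phi(1,\ldots,1,x,1,\ldots,1)$ for $x\in K^*$, with $x$ in the $j$-th position, so that $\phi(x_1,\ldots,x_p)=\phi_1(x_1)\cdots\phi_p(x_p)$ on $(K^* )^p$), such that, with $\mathrm{diag}\,\phi(x):=\phi_1(x)\cdots\phi_p(x)$, $$\sum_{i=1}^n a_i\,\mathrm{diag}\,\phi(\alpha_i x+\beta_i y)=\tilde c_p\cdot\sum_{l=0}^p x^l y^{p-l}\qquad (x,y\in K)$$ for some $\tilde c_p\in\mathbb{C}$. In particular, $$\sum_{i=1}^n a_i\phi_1(\alpha_i)\cdots\phi_p(\alpha_i)=\sum_{i=1}^n a_i\phi_1(\beta_i)\cdots\phi_p(\beta_i)=\sum_{i=1}^n a_i\binom{p}{l}\phi_{\sigma(1)}(\alpha_i)\cdots\phi_{\sigma(l)}(\alpha_i)\,\phi_{\sigma(l+1)}(\beta_i)\cdots\phi_{\sigma(p)}(\beta_i)=\tilde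 c_p$$ for every $l=1,\ldots,p-1$ and every permutation $\sigma$ of $\{1,\ldots,p\}$. If $\tilde c_p=0$, then $$\sum_{i=1}^n a_i\,\mathrm{diag}\,\phi(\alpha_i x+\beta_i y)=0\qquad (x,y\in\mathbb{C}),$$ i.e. $\mathrm{diag}\,\phi$ is a solution of the homogeneous equation on $\mathbb{C}$. If $\tilde c_p\neq 0$, then $\phi_1(x)=\cdots=\phi_p(x)=x$ for all $x\in K$ and $$\sum_{i=1}^n a_i\alpha_i^p=\sum_{i=1}^n a_i\beta_i^p=\sum_{i=1}^n a_i\binom{p}{l}\alpha_i^l\beta_i^{p-l}=\tilde c_p\neq 0\qquad (l=1,\ldots,p-1). \qquad ( * )$$ Conversely, if $c\neq 0$ and $( * )$ holds for some $\tilde c_p\in\mathbb{C}$, then $f(x):=(c/\tilde c_p)\cdot x^p$ is a nonzero monomial solution of degree $p$ on $\mathbb{C}$ of $\sum_{i=1}^n a_i f(\alpha_i x+\beta_i y)=c\cdot\sum_{l=0}^p x^l y^{p-l}$.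
   Context: Standing setting: $n\in\mathbb{N}$, $a_1,\ldots,a_n\in\mathbb{C}$, and $\alpha_1,\ldots,\alpha_n,\beta_1,\ldots,\beta_n\in\mathbb{C}$ satisfy $\alpha_i+\beta_i\neq 0$ for all $i$ and $\alpha_i\beta_j-\alpha_j\beta_i\neq 0$ for all $i\neq j$. A generalized monomial of degree $p$ is a function $f(x)=F(x,\ldots,x)$ where $F$ is a symmetric $p$-additive function (additive in each of its $p$ variables) with complex values. For a finitely generated subfield $K\subset\mathbb{C}$ containing all $\alpha_i,\beta_i$, let $V_p$ be the set of $p$-additive functions $K^p\to\mathbb{C}$. For $F\in V_p$ and a permutation $\sigma$ of $\{1,\ldots,p\}$ put $F^\sigma(w_1,\ldots,w_p)=F(w_{\sigma(1)},\ldots,w_{\sigma(p)})$. Let $S_p$ be the set of all $\tilde F\in V_p$ for which there exists $\tilde c_p\in\mathbb{C}$ such that for every permutation $\sigma$ of $\{1,\ldots,p\}$, every $l=1,\ldots,p-1$ and all $x_j,y_j\in K$: $$\sum_{i=1}^n a_i\tilde F^\sigma(\alpha_i x_1,\ldots,\alpha_i x_p)=\tilde c_p\,x_1\cdots x_p,\qquad \sum_{i=1}^n a_i\tilde F^\sigma(\beta_i y_1,\ldots,\beta_i y_p)=\tilde c_p\,y_1\cdots y_p,$$ $$\sum_{i=1}^n a_i\binom{p}{l}\tilde F^\sigma(\alpha_i x_1,\ldots,\alpha_i x_l,\beta_i y_1,\ldots,\beta_i y_{p-l})=\tilde c_p\,x_1\cdots x_l\,y_1\cdots y_{p-l}.$$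 Let $K^*=K\setminus\{0\}$, let $G^*=(K^* )^p$ be the multiplicative group with componentwise multiplication, and let $S_p^*$ be the set of restrictions to $G^*$ of the elements of $S_p$. An exponential on an Abelian group $(G,* )$ is a (not identically zero) function $m\colon G\to\mathbb{C}$ with $m(x*y)=m(x)m(y)$ for all $x,y\in G$. *)

theory Defs
  imports
    Complex_Main
    "HOL-Combinatorics.Permutations"
    "HOL-Algebra.Algebra"
    "HOL-Algebra.Algebraic_Closure_Type"
begin

text \<open>
  Families indexed by 1, ..., n (such as the coefficients) are functions on \<^typ>\<open>nat\<close> of which
  only the values on {1..n} are used.  An element of the p-fold power of a set is an extensional
  function on {1..p}, and a function on such a power is extensional as well, so that the function
  spaces below are honest sets of functions on their domains.
\<close>

abbreviation complex_field :: "complex ring" where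
  "complex_field \<equiv> ring_of_type_algebra"

abbreviation tuples :: "nat \<Rightarrow> complex set \<Rightarrow> (nat \<Rightarrow> complex) set" where
  "tuples p K \<equiv> {1..p} \<rightarrow>\<^sub>E K"

definition finitely_generated_subfield :: "complex set \<Rightarrow> bool" where
  "finitely_generated_subfield K \<longleftrightarrow>
     subfield K complex_field \<and> (\<exists>S. finite S \<and> K = generate_field complex_field S)"

definition multiadditive :: "nat \<Rightarrow> complex set \<Rightarrow> ((nat \<Rightarrow> complex) \<Rightarrow> complex) set" where
  "multiadditive p K =
     {F \<in> tuples p K \<rightarrow>\<^sub>E UNIV.
        \<forall>w\<in>tuples p K. \<forall>j\<in>{1..p}. \<forall>u\<in>K. \<forall>v\<in>K.
          F (w(j := u + v)) = F (w(j := u)) + F (w(j := v))}"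

definition permute_args ::
  "nat \<Rightarrow> (nat \<Rightarrow> nat) \<Rightarrow> ((nat \<Rightarrow> complex) \<Rightarrow> complex) \<Rightarrow> (nat \<Rightarrow> complex) \<Rightarrow> complex" where
  "permute_args p \<sigma> F = (\<lambda>w. F (\<lambda>k\<in>{1..p}. w (\<sigma> k)))"

definition generalized_monomial :: "nat \<Rightarrow> (complex \<Rightarrow> complex) \<Rightarrow> bool" where
  "generalized_monomial p f \<longleftrightarrow>
     (\<exists>F\<in>multiadditive p UNIV.
        (\<forall>\<sigma>. \<sigma> permutes {1..p} \<longrightarrow> (\<forall>w\<in>tuples p UNIV. permute_args p \<sigma> F w = F w)) \<and>
        (\<forall>x. f x = F (\<lambda>k\<in>{1..p}. x)))"

text \<open>
  The constant c may depend on F, but it is the same for all permutations and all three identities;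
  the third one takes its first l arguments from x and the remaining p - l ones from y.
\<close>

definition S_space ::
  "nat \<Rightarrow> (nat \<Rightarrow> complex) \<Rightarrow> (nat \<Rightarrow> complex) \<Rightarrow> (nat \<Rightarrow> complex) \<Rightarrow> nat \<Rightarrow> complex set \<Rightarrow>
    ((nat \<Rightarrow> complex) \<Rightarrow> complex) set" where
  "S_space n a \<alpha> \<beta> p K =
     {F \<in> multiadditive p K.
        \<exists>c. \<forall>\<sigma>. \<sigma> permutes {1..p} \<longrightarrow>
          (\<forall>x\<in>tuples p K.
             (\<Sum>i=1..n. a i * permute_args p \<sigma> F (\<lambda>k\<in>{1..p}. \<alpha> i * x k)) = c * (\<Prod>k=1..p. x k)) \<and>
          (\<forall>y\<in>tuples p K.
             (\<Sum>i=1..n. a i * permute_args p \<sigma> F (\<lambda>k\<in>{1..p}. \<beta> i * y k)) = c * (\<Prod>k=1..p. y k)) \<and>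
          (\<forall>l\<in>{1..p-1}. \<forall>x\<in>tuples p K. \<forall>y\<in>tuples p K.
             (\<Sum>i=1..n. a i * of_nat (p choose l) *
                permute_args p \<sigma> F (\<lambda>k\<in>{1..p}. if k \<le> l then \<alpha> i * x k else \<beta> i * y (k - l))) =
             c * (\<Prod>k=1..l. x k) * (\<Prod>k=1..p-l. y k))}"

definition G_star :: "nat \<Rightarrow> complex set \<Rightarrow> (nat \<Rightarrow> complex) monoid" where
  "G_star p K = product_group {1..p} (\<lambda>_. mult_of (complex_field\<lparr>carrier := K\<rparr>))"

definition S_star ::
  "nat \<Rightarrow> (nat \<Rightarrow> complex) \<Rightarrow> (nat \<Rightarrow> complex) \<Rightarrow> (nat \<Rightarrow> complex) \<Rightarrow> nat \<Rightarrow> complex set \<Rightarrow>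
    ((nat \<Rightarrow> complex) \<Rightarrow> complex) set" where
  "S_star n a \<alpha> \<beta> p K = (\<lambda>F. restrict F (carrier (G_star p K))) ` S_space n a \<alpha> \<beta> p K"

definition exponential_on :: "('g, 'm) monoid_scheme \<Rightarrow> ('g \<Rightarrow> complex) \<Rightarrow> bool" where
  "exponential_on G m \<longleftrightarrow>
     (\<exists>x\<in>carrier G. m x \<noteq> 0) \<and>
     (\<forall>x\<in>carrier G. \<forall>y\<in>carrier G. m (x \<otimes>\<^bsub>G\<^esub> y) = m x * m y)"

lemma carrier_G_star: "carrier (G_star p K) = tuples p (K - {0})"
  by (simp add: G_star_def ring_of_type_algebra_def)

lemma mult_G_star: "x \<otimes>\<^bsub>G_star p K\<^esub> y = (\<lambda>k\<in>{1..p}. x k * y k)"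
  by (simp add: G_star_def ring_of_type_algebra_def)

definition solves_on ::
  "complex set \<Rightarrow> nat \<Rightarrow> (nat \<Rightarrow> complex) \<Rightarrow> (nat \<Rightarrow> complex) \<Rightarrow> (nat \<Rightarrow> complex) \<Rightarrow> nat \<Rightarrow> complex \<Rightarrow>
    (complex \<Rightarrow> complex) \<Rightarrow> bool" where
  "solves_on D n a \<alpha> \<beta> p c f \<longleftrightarrow>
     (\<forall>x\<in>D. \<forall>y\<in>D. (\<Sum>i=1..n. a i * f (\<alpha> i * x + \<beta> i * y)) = c * (\<Sum>l=0..p. x ^ l * y ^ (p - l)))"

definition power_condition ::
  "nat \<Rightarrow> (nat \<Rightarrow> complex) \<Rightarrow> (nat \<Rightarrow> complex) \<Rightarrow> (nat \<Rightarrow> complex) \<Rightarrow> nat \<Rightarrow> complex \<Rightarrow> bool" where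
  "power_condition n a \<alpha> \<beta> p c \<longleftrightarrow>
     (\<Sum>i=1..n. a i * \<alpha> i ^ p) = c \<and>
     (\<Sum>i=1..n. a i * \<beta> i ^ p) = c \<and>
     (\<forall>l\<in>{1..p-1}. (\<Sum>i=1..n. a i * of_nat (p choose l) * \<alpha> i ^ l * \<beta> i ^ (p - l)) = c) \<and>
     c \<noteq> 0"

end

theory Submission
  imports
    Defs
    "HOL-Library.Poly_Mapping"
    "HOL-Computational_Algebra.Fundamental_Theorem_Algebra"
    "HOL-Analysis.Continuum_Not_Denumerable"
    "HOL-Analysis.Finite_Cartesian_Product"
begin

text \<open>
  Let F be the symmetric p-additive function with diagonal f.  Both sides of the equation are
  diagonals of symmetric p-additive functions of the pairs (x, y), so by polarization the
  equation holds for F argument by argument.  Hence F satisfies linear relations between its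
  multiplicative translates which express additivity in each variable and the identities defining
  S.  Let K be generated by the parameters together with a point where f does not vanish.
  The relations of F form a proper ideal of a complex algebra of countable dimension.
  Its maximal ideals have residue field \<open>\<complex>\<close>, since the elements 1 / (t - l) for complex l would
  otherwise be uncountably many independent ones.  A character that vanishes on the ideal is the
  exponential \<open>\<phi>\<close>: it obeys all relations of F and so is a product of field embeddings.

  An embedding of a countable field extends to an automorphism of \<open>\<complex>\<close>: a countable
  back-and-forth first makes domain and range generate the same algebraically closed field, and
  Zorn's lemma then applies to the partial isomorphisms with that property.
\<close>

section \<open>Extending countable partial isomorphisms to automorphisms\<close>

text \<open>The right-hand side of the equation is not built from \<open>F\<close>, so c cannot
  survive the passage to a character. Polarization gives one identity for each set \<open>A\<close>
  of arguments that carry \<alpha>, with right-hand side c times the product of the arguments,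
  divided by a binomial coefficient that depends on \<open>card A\<close>. Comparing two sets
  eliminates c and leaves a relation between translates of \<open>F\<close>; the character then has
  its own constant \<open>ct\<close>. Multiplying the arguments by a tuple x only multiplies the
  right-hand side by the product of x. This too is a relation, and for the character it reads ct *
  \<phi>(x) = ct * x_1 ... x_p. Hence the dichotomy: either ct = 0, or \<phi> is the product and
  every \<psi>_j is the identity on K. Extending the coordinate embeddings beyond K is what carries
  the case ct = 0 to all complex x and y. Zorn's lemma on all partial isomorphisms would not give
  automorphisms: \<complex> is isomorphic to proper subfields, and such an isomorphism is maximal
  without being onto. This is why domain and range are kept in balance.\<close>

text \<open>
  The graph of an isomorphism between two subrings of \<open>\<complex>\<close>; a graph rather than a function keeps
  domain and range symmetric.
\<close>

definition partial_iso :: "(complex \<times> complex) set \<Rightarrow> bool" where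
  "partial_iso r \<longleftrightarrow> (1, 1) \<in> r \<and>
     (\<forall>x x' y y'. (x, x') \<in> r \<longrightarrow> (y, y') \<in> r \<longrightarrow> (x - y, x' - y') \<in> r \<and> (x * y, x' * y') \<in> r) \<and>
     (\<forall>x x'. (x, x') \<in> r \<longrightarrow> (x = 0 \<longleftrightarrow> x' = 0))"

text \<open>The inverse of x is the root of a linear polynomial with coefficients x and -1, so these
  sets are the algebraically closed subfields of \<complex>. Quantifying over them replaces forming
  the algebraic closure of a set inside \<complex>.\<close>

definition root_closed :: "complex set \<Rightarrow> bool" where
  "root_closed Y \<longleftrightarrow> 1 \<in> Y \<and> (\<forall>x\<in>Y. \<forall>y\<in>Y. x - y \<in> Y \<and> x * y \<in> Y) \<and>
     (\<forall>q z. q \<noteq> 0 \<longrightarrow> range (coeff q) \<subseteq> Y \<longrightarrow> poly q z = 0 \<longrightarrow> z \<in> Y)"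

definition poly_pairs :: "(complex \<times> complex) set \<Rightarrow> (complex poly \<times> complex poly) set" where
  "poly_pairs r = {(q, q'). \<forall>i. (coeff q i, coeff q' i) \<in> r}"

text \<open>The extension of r that is forced once t is to correspond to t'. It reaches the ring
  generated by t and not its field of fractions, which suffices because \<open>partial_iso\<close>
  asks only for subrings.\<close>

definition adjoin :: "(complex \<times> complex) set \<Rightarrow> complex \<Rightarrow> complex \<Rightarrow> (complex \<times> complex) set" where
  "adjoin r t t' = (\<lambda>(q, q'). (poly q t, poly q' t')) ` poly_pairs r"

lemma partial_iso_converse [simp]: "partial_iso (r\<inverse>) \<longleftrightarrow> partial_iso r"
proof -
  have "partial_iso (r\<inverse>)" if "partial_iso r" for r
    using that unfolding partial_iso_def by (simp add: converse_iff)
  then show ?thesis by (metis converse_converse)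
qed

section \<open>Polynomials with corresponding coefficients and adjunction of one element\<close>

context
  fixes r assumes r: "partial_iso r"
begin

lemma partial_iso_one: "(1, 1) \<in> r"
  and partial_iso_diff: "(x, x') \<in> r \<Longrightarrow> (y, y') \<in> r \<Longrightarrow> (x - y, x' - y') \<in> r"
  and partial_iso_mult: "(x, x') \<in> r \<Longrightarrow> (y, y') \<in> r \<Longrightarrow> (x * y, x' * y') \<in> r"
  and partial_iso_zero_iff: "(x, x') \<in> r \<Longrightarrow> x = 0 \<longleftrightarrow> x' = 0"
  using r unfolding partial_iso_def by blast+

lemma partial_iso_zero: "(0, 0) \<in> r"
  using partial_iso_diff[OF partial_iso_one partial_iso_one] by simp

lemma partial_iso_add: "(x, x') \<in> r \<Longrightarrow> (y, y') \<in> r \<Longrightarrow> (x + y, x' + y') \<in> r"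
  using partial_iso_diff[OF _ partial_iso_diff[OF partial_iso_zero], of x x' y y'] by simp

lemma partial_iso_sum: "(\<And>i. i \<in> A \<Longrightarrow> (f i, g i) \<in> r) \<Longrightarrow> (sum f A, sum g A) \<in> r"
  by (induction A rule: infinite_finite_induct) (auto intro: partial_iso_add partial_iso_zero)

lemma partial_iso_eq_iff: "(x, x') \<in> r \<Longrightarrow> (y, y') \<in> r \<Longrightarrow> x = y \<longleftrightarrow> x' = y'"
  using partial_iso_diff[of x x' y y'] partial_iso_zero_iff[of "x - y" "x' - y'"] by simp

lemma poly_pairs_const: "(x, x') \<in> r \<Longrightarrow> ([:x:], [:x':]) \<in> poly_pairs r"
  by (auto simp: poly_pairs_def coeff_pCons partial_iso_zero split: nat.splits)

lemma poly_pairs_monom: "(x, x') \<in> r \<Longrightarrow> (monom x k, monom x' k) \<in> poly_pairs r"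
  by (auto simp: poly_pairs_def partial_iso_zero)

lemma poly_pairs_diff: "(q, q') \<in> poly_pairs r \<Longrightarrow> (s, s') \<in> poly_pairs r \<Longrightarrow> (q - s, q' - s') \<in> poly_pairs r"
  by (auto simp: poly_pairs_def partial_iso_diff)

lemma poly_pairs_add: "(q, q') \<in> poly_pairs r \<Longrightarrow> (s, s') \<in> poly_pairs r \<Longrightarrow> (q + s, q' + s') \<in> poly_pairs r"
  by (auto simp: poly_pairs_def partial_iso_add)

lemma poly_pairs_mult: "(q, q') \<in> poly_pairs r \<Longrightarrow> (s, s') \<in> poly_pairs r \<Longrightarrow> (q * s, q' * s') \<in> poly_pairs r"
  by (auto simp: poly_pairs_def coeff_mult intro!: partial_iso_sum partial_iso_mult)

lemma poly_pairs_smult: "(x, x') \<in> r \<Longrightarrow> (q, q') \<in> poly_pairs r \<Longrightarrow> (smult x q, smult x' q') \<in> poly_pairs r"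
  by (auto simp: poly_pairs_def partial_iso_mult)

lemma poly_pairs_zero_iff: "(q, q') \<in> poly_pairs r \<Longrightarrow> q = 0 \<longleftrightarrow> q' = 0"
  using partial_iso_zero_iff unfolding poly_pairs_def poly_eq_iff by auto

lemma poly_pairs_degree: "(q, q') \<in> poly_pairs r \<Longrightarrow> degree q' = degree q"
  using partial_iso_zero_iff unfolding poly_pairs_def degree_def by (auto intro!: arg_cong[of _ _ Least] ext)

lemma poly_pairs_lead_coeff: "(q, q') \<in> poly_pairs r \<Longrightarrow> (lead_coeff q, lead_coeff q') \<in> r"
  by (simp add: poly_pairs_degree) (simp add: poly_pairs_def)

lemma poly_pairs_exists: "range (coeff q) \<subseteq> Domain r \<Longrightarrow> \<exists>q'. (q, q') \<in> poly_pairs r"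
proof (induction q)
  case 0
  then show ?case using poly_pairs_const[OF partial_iso_zero] by auto
next
  case (pCons a q)
  have "coeff q i \<in> Domain r" for i
    using pCons.prems by (metis coeff_pCons_Suc range_subsetD)
  then obtain q' where q': "(q, q') \<in> poly_pairs r" using pCons.IH by blast
  have "a \<in> Domain r" using pCons.prems by (metis coeff_pCons_0 range_subsetD)
  then obtain a' where "(a, a') \<in> r" by auto
  with q' have "(pCons a q, pCons a' q') \<in> poly_pairs r"
    by (auto simp: poly_pairs_def coeff_pCons split: nat.splits)
  then show ?case by blast
qed

text \<open>Leading coefficients need not be invertible in the domain of r, so q is scaled by the
  leading coefficient of s in each round. Carrying the second components along keeps the divisions
  on the two sides in correspondence.\<close>

lemma poly_pairs_pseudo_division:
  assumes s: "(s, s') \<in> poly_pairs r" "s \<noteq> 0"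
  shows "(q, q') \<in> poly_pairs r \<Longrightarrow> \<exists>c c' u u' v v'. (c, c') \<in> r \<and> c \<noteq> 0 \<and>
    (u, u') \<in> poly_pairs r \<and> (v, v') \<in> poly_pairs r \<and>
    smult c q = s * u + v \<and> smult c' q' = s' * u' + v' \<and> (v = 0 \<or> degree v < degree s)"
proof (induction "degree q" arbitrary: q q' rule: less_induct)
  case less
  show ?case
  proof (cases "q = 0 \<or> degree q < degree s")
    case True
    then show ?thesis
      using partial_iso_one poly_pairs_const[OF partial_iso_zero] less.prems
      by (intro exI[of _ 1] exI[of _ 0] exI[of _ q] exI[of _ q'] conjI) auto
  next
    case False
    define k where "k = degree q - degree s"
    define b b' where "b = lead_coeff s" and "b' = lead_coeff s'"
    define m m' where "m = monom (lead_coeff q) k" and "m' = monom (lead_coeff q') k"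
    \<comment> \<open>Both terms have the degree of q and the same leading coefficient, so the
      difference has smaller degree or is zero.\<close>
    define v v' where "v = smult b q - s * m" and "v' = smult b' q' - s' * m'"
    have b: "(b, b') \<in> r" "b \<noteq> 0"
      using poly_pairs_lead_coeff[OF s(1)] s(2) by (auto simp: b_def b'_def)
    have m: "(m, m') \<in> poly_pairs r"
      unfolding m_def m'_def by (intro poly_pairs_monom poly_pairs_lead_coeff less.prems)
    have v: "(v, v') \<in> poly_pairs r"
      unfolding v_def v'_def by (intro poly_pairs_diff poly_pairs_smult poly_pairs_mult b m s less.prems)
    have "degree m = k" "m \<noteq> 0"
      using False by (simp_all add: m_def degree_monom_eq monom_eq_0_iff)
    then have dm: "degree (s * m) = degree q"
      using False s(2) by (simp add: degree_mult_eq k_def)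
    have lm: "lead_coeff (s * m) = lead_coeff (smult b q)"
      by (simp only: lead_coeff_mult lead_coeff_smult m_def b_def lead_coeff_monom)
    have "v = 0 \<or> degree v < degree q"
    proof (cases "v = 0")
      case False
      have "degree v \<le> degree q"
        unfolding v_def by (rule degree_diff_le) (auto simp: dm degree_smult_le)
      moreover have "coeff v (degree q) = 0"
        using lm b(2) by (simp add: v_def dm)
      ultimately show ?thesis
        using False by (metis le_neq_implies_less leading_coeff_0_iff)
    qed simp
    then have "\<exists>c c' u u' w w'. (c, c') \<in> r \<and> c \<noteq> 0 \<and>
      (u, u') \<in> poly_pairs r \<and> (w, w') \<in> poly_pairs r \<and>
      smult c v = s * u + w \<and> smult c' v' = s' * u' + w' \<and> (w = 0 \<or> degree w < degree s)"
    proof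
      assume "v = 0"
      then have "v' = 0" using poly_pairs_zero_iff[OF v] by simp
      then show ?thesis using \<open>v = 0\<close> partial_iso_one poly_pairs_const[OF partial_iso_zero]
        by (intro exI[of _ 1] exI[of _ 0] conjI) auto
    qed (use less.hyps v in blast)
    then obtain c c' u u' w w' where *: "(c, c') \<in> r" "c \<noteq> 0"
      "(u, u') \<in> poly_pairs r" "(w, w') \<in> poly_pairs r"
      "smult c v = s * u + w" "smult c' v' = s' * u' + w'" "w = 0 \<or> degree w < degree s"
      by blast
    show ?thesis
    proof (intro exI conjI)
      show "(c * b, c' * b') \<in> r" "c * b \<noteq> 0" using * b by (auto intro: partial_iso_mult)
      show "(u + smult c m, u' + smult c' m') \<in> poly_pairs r" by (intro poly_pairs_add poly_pairs_smult m *)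
      show "(w, w') \<in> poly_pairs r" "w = 0 \<or> degree w < degree s" by fact+
      have "smult (c * b) q = smult c v + s * smult c m"
        by (simp add: v_def smult_diff_right)
      then show "smult (c * b) q = s * (u + smult c m) + w" by (simp add: * algebra_simps)
      have "smult (c' * b') q' = smult c' v' + s' * smult c' m'"
        by (simp add: v'_def smult_diff_right)
      then show "smult (c' * b') q' = s' * (u' + smult c' m') + w'" by (simp add: * algebra_simps)
    qed
  qed
qed

lemma subset_adjoin: "r \<subseteq> adjoin r t t'"
proof (clarify)
  fix x y assume "(x, y) \<in> r"
  from poly_pairs_const[OF this] show "(x, y) \<in> adjoin r t t'"
    unfolding adjoin_def by (force intro: image_eqI)
qed

lemma in_adjoin: "(t, t') \<in> adjoin r t t'"
  using poly_pairs_monom[OF partial_iso_one, of 1] unfolding adjoin_def by (force simp: poly_monom)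

text \<open>Two polynomial values agree exactly if their difference vanishes; transfer of vanishing
  in both directions therefore makes the correspondence single-valued and injective.\<close>

lemma partial_iso_adjoin:
  assumes "\<And>q q'. (q, q') \<in> poly_pairs r \<Longrightarrow> poly q t = 0 \<longleftrightarrow> poly q' t' = 0"
  shows "partial_iso (adjoin r t t')"
  unfolding partial_iso_def
proof (intro conjI allI impI)
  show "(1, 1) \<in> adjoin r t t'" using subset_adjoin partial_iso_one by blast
next
  fix x x' y y' assume "(x, x') \<in> adjoin r t t'" "(y, y') \<in> adjoin r t t'"
  then obtain q q' s s' where *: "(q, q') \<in> poly_pairs r" "(s, s') \<in> poly_pairs r"
    "x = poly q t" "x' = poly q' t'" "y = poly s t" "y' = poly s' t'"
    unfolding adjoin_def by auto
  show "(x - y, x' - y') \<in> adjoin r t t'"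
    unfolding adjoin_def by (rule image_eqI[OF _ poly_pairs_diff[OF *(1,2)]]) (simp add: *)
  show "(x * y, x' * y') \<in> adjoin r t t'"
    unfolding adjoin_def by (rule image_eqI[OF _ poly_pairs_mult[OF *(1,2)]]) (simp add: *)
qed (use assms in \<open>auto simp: adjoin_def\<close>)

text \<open>The partner t' is a root of the counterpart of a polynomial m of least degree that
  vanishes at t. Pseudo-division by m reduces every pair to remainders of smaller degree, and these
  vanish at t, or at t', only if they are zero.\<close>

lemma algebraic_partner:
  assumes q: "q \<noteq> 0" "range (coeff q) \<subseteq> Domain r" "poly q t = 0"
  shows "\<exists>t' m m'. (m, m') \<in> poly_pairs r \<and> m \<noteq> 0 \<and> poly m' t' = 0 \<and>
    (\<forall>q q'. (q, q') \<in> poly_pairs r \<longrightarrow> poly q t = 0 \<longleftrightarrow> poly q' t' = 0)"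
proof -
  \<comment> \<open>The predicate P is left open because a pair of least degree is needed twice: for
    vanishing at t and for vanishing at t'.\<close>
  have *: "\<exists>m m'. P m m' \<and> (m, m') \<in> poly_pairs r \<and> m \<noteq> 0 \<and>
      (\<forall>q q'. (q, q') \<in> poly_pairs r \<longrightarrow> P q q' \<longrightarrow> degree q < degree m \<longrightarrow> q = 0)"
    if "P q q'" "(q, q') \<in> poly_pairs r" "q \<noteq> 0" for q q' P
  proof -
    define Q where "Q = (\<lambda>(m, m'). P m m' \<and> (m, m') \<in> poly_pairs r \<and> m \<noteq> 0)"
    have "Q (q, q')" using that by (simp add: Q_def)
    then obtain x where x: "Q x" "\<And>y. Q y \<Longrightarrow> degree (fst x) \<le> degree (fst y)"
      using ex_has_least_nat[of Q "(q, q')" "\<lambda>x. degree (fst x)"] by blast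
    obtain m m' where [simp]: "x = (m, m')" by fastforce
    have "q = 0" if "(q, q') \<in> poly_pairs r" "P q q'" "degree q < degree m" for q q'
      using x(2)[of "(q, q')"] that by (auto simp: Q_def)
    moreover have "P m m'" "(m, m') \<in> poly_pairs r" "m \<noteq> 0" using x(1) by (simp_all add: Q_def)
    ultimately show ?thesis by blast
  qed
  obtain q' where q': "(q, q') \<in> poly_pairs r" using poly_pairs_exists q by blast
  from *[of "\<lambda>q q'. poly q t = 0", OF q(3) q' q(1)]
  obtain m m' where m: "poly m t = 0" "(m, m') \<in> poly_pairs r" "m \<noteq> 0"
    and "\<forall>q q'. (q, q') \<in> poly_pairs r \<longrightarrow> poly q t = 0 \<longrightarrow> degree q < degree m \<longrightarrow> q = 0"
    by (elim exE conjE) (rule that)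
  then have m_min: "\<And>q q'. (q, q') \<in> poly_pairs r \<Longrightarrow> poly q t = 0 \<Longrightarrow> degree q < degree m \<Longrightarrow> q = 0"
    by blast
  have deg_pos: "degree m > 0" if "poly m z = 0" "m \<noteq> 0" for m :: "complex poly" and z
  proof (rule ccontr)
    assume "\<not> degree m > 0"
    then obtain a where "m = [:a:]" by (auto elim: degree_eq_zeroE)
    with that show False by simp
  qed
  have "degree m > 0" using deg_pos m(1,3) .
  then obtain t' where t': "poly m' t' = 0"
    using alg_closed_imp_poly_has_root[of m'] poly_pairs_degree[OF m(2)] by auto
  from *[of "\<lambda>q q'. poly q' t' = 0", OF t' m(2,3)]
  obtain s s' where s: "poly s' t' = 0" "(s, s') \<in> poly_pairs r" "s \<noteq> 0"
    and "\<forall>q q'. (q, q') \<in> poly_pairs r \<longrightarrow> poly q' t' = 0 \<longrightarrow> degree q < degree s \<longrightarrow> q = 0"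
    by (elim exE conjE) (rule that)
  then have s_min: "\<And>q q'. (q, q') \<in> poly_pairs r \<Longrightarrow> poly q' t' = 0 \<Longrightarrow> degree q < degree s \<Longrightarrow> q = 0"
    by blast
  have "s' \<noteq> 0" using s poly_pairs_zero_iff by blast
  then have "degree s' > 0" using deg_pos s(1) by blast
  then have ds: "degree s > 0" using poly_pairs_degree[OF s(2)] by simp
  \<comment> \<open>s divides a multiple c m of the minimal polynomial m of t; neither factor may have smaller degree
    and vanish at t, so s has the degree of m.\<close>
  have ms: "degree m \<le> degree s"
  proof -
    obtain c c' u u' v v' where *: "(c, c') \<in> r" "c \<noteq> 0"
      "(u, u') \<in> poly_pairs r" "(v, v') \<in> poly_pairs r"
      "smult c m = s * u + v" "smult c' m' = s' * u' + v'" "v = 0 \<or> degree v < degree s"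
      using poly_pairs_pseudo_division[OF s(2,3) m(2)] by blast
    have "poly (smult c' m') t' = poly (s' * u' + v') t'" using * by simp
    then have "poly v' t' = 0" by (simp add: t' s)
    then have v: "v = 0" using *(4,7) s_min by blast
    then have eq: "smult c m = s * u" using * by simp
    then have u: "u \<noteq> 0" using m(3) *(2) by auto
    have "degree m = degree s + degree u"
      using arg_cong[OF eq, of degree] *(2) u s(3) by (simp add: degree_mult_eq)
    then have "poly u t \<noteq> 0" using m_min[OF *(3)] u ds by force
    moreover have "poly s t * poly u t = 0"
      using arg_cong[OF eq, of "\<lambda>q. poly q t"] by (simp add: m)
    ultimately show ?thesis using m_min[OF s(2)] s(3) by fastforce
  qed
  show ?thesis
  proof (intro exI conjI allI impI)
    show "(m, m') \<in> poly_pairs r" "m \<noteq> 0" "poly m' t' = 0" by fact+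
    fix q q' assume q: "(q, q') \<in> poly_pairs r"
    obtain c c' u u' v v' where *: "(c, c') \<in> r" "c \<noteq> 0"
      "(u, u') \<in> poly_pairs r" "(v, v') \<in> poly_pairs r"
      "smult c q = m * u + v" "smult c' q' = m' * u' + v'" "v = 0 \<or> degree v < degree m"
      using poly_pairs_pseudo_division[OF m(2,3) q] by blast
    have "poly v t = c * poly q t"
      using arg_cong[OF *(5), of "\<lambda>q. poly q t"] by (simp add: m)
    moreover have "poly v' t' = c' * poly q' t'"
      using arg_cong[OF *(6), of "\<lambda>q. poly q t'"] by (simp add: t')
    moreover have "c' \<noteq> 0" using * partial_iso_zero_iff by blast
    moreover have "poly v t = 0 \<longleftrightarrow> v = 0" "poly v' t' = 0 \<longleftrightarrow> v' = 0"
      using m_min[OF *(4)] s_min[OF *(4)] *(7) ms poly_pairs_zero_iff[OF *(4)] by auto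
    ultimately show "poly q t = 0 \<longleftrightarrow> poly q' t' = 0"
      using *(2) poly_pairs_zero_iff[OF *(4)] by simp
  qed
qed

end

lemma converse_adjoin: "(adjoin r t t')\<inverse> = adjoin (r\<inverse>) t' t"
  unfolding adjoin_def poly_pairs_def by (auto simp: image_iff) 

section \<open>Root-closed sets, countability and the back-and-forth\<close>

lemma root_closed_root:
  assumes "root_closed Y" "q \<noteq> 0" "range (coeff q) \<subseteq> Y" "poly q z = 0"
  shows "z \<in> Y"
  using assms unfolding root_closed_def by blast

lemma root_closed_poly:
  assumes "root_closed Y" "range (coeff q) \<subseteq> Y" "t \<in> Y"
  shows "poly q t \<in> Y"
proof -
  have Y: "1 \<in> Y" "\<And>x y. x \<in> Y \<Longrightarrow> y \<in> Y \<Longrightarrow> x - y \<in> Y" "\<And>x y. x \<in> Y \<Longrightarrow> y \<in> Y \<Longrightarrow> x * y \<in> Y"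
    using assms(1) unfolding root_closed_def by auto
  have "0 \<in> Y" using Y(2)[OF Y(1) Y(1)] by simp
  then have add: "x + y \<in> Y" if "x \<in> Y" "y \<in> Y" for x y
    using Y(2)[OF that(1) Y(2)[OF \<open>0 \<in> Y\<close> that(2)]] by simp
  show ?thesis using assms(2)
  proof (induction q)
    case (pCons a q)
    have "coeff q i \<in> Y" for i
      using pCons.prems by (metis coeff_pCons_Suc range_subsetD)
    moreover have "a \<in> Y" using pCons.prems by (metis coeff_pCons_0 range_subsetD)
    ultimately show ?case using pCons.IH Y add assms(3) by (simp add: image_subset_iff)
  qed (use \<open>0 \<in> Y\<close> in simp)
qed

text \<open>As far as root-closed supersets are concerned, passing to \<open>adjoin r t t'\<close>
  adds the single element t to the domain. This is how balance is tracked under extensions.\<close>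

lemma Domain_adjoin_subset_iff:
  assumes "partial_iso r" "root_closed Y"
  shows "Domain (adjoin r t t') \<subseteq> Y \<longleftrightarrow> Domain r \<subseteq> Y \<and> t \<in> Y"
proof
  assume "Domain (adjoin r t t') \<subseteq> Y"
  then show "Domain r \<subseteq> Y \<and> t \<in> Y"
    using subset_adjoin[OF assms(1), of t t'] in_adjoin[OF assms(1), of t t'] by blast
next
  assume Y: "Domain r \<subseteq> Y \<and> t \<in> Y"
  have "poly q t \<in> Y" if "(q, q') \<in> poly_pairs r" for q q'
    using that Y by (intro root_closed_poly[OF assms(2)]) (auto simp: poly_pairs_def)
  then show "Domain (adjoin r t t') \<subseteq> Y"
    unfolding adjoin_def by auto
qed

lemma Range_adjoin_subset_iff:
  assumes "partial_iso r" "root_closed Y"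
  shows "Range (adjoin r t t') \<subseteq> Y \<longleftrightarrow> Range r \<subseteq> Y \<and> t' \<in> Y"
  using Domain_adjoin_subset_iff[of "r\<inverse>" Y t' t] assms
  by (simp flip: converse_adjoin)

lemma partial_iso_Union:
  assumes "C \<noteq> {}" "\<And>r. r \<in> C \<Longrightarrow> partial_iso r" "\<And>r s. r \<in> C \<Longrightarrow> s \<in> C \<Longrightarrow> r \<subseteq> s \<or> s \<subseteq> r"
  shows "partial_iso (\<Union>C)"
  unfolding partial_iso_def
proof (intro conjI allI impI)
  show "(1, 1) \<in> \<Union>C" using assms(1,2) partial_iso_one by blast
next
  fix x x' y y' assume "(x, x') \<in> \<Union>C" "(y, y') \<in> \<Union>C"
  then obtain r where r: "r \<in> C" "(x, x') \<in> r" "(y, y') \<in> r"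
    using assms(3) by blast
  then show "(x - y, x' - y') \<in> \<Union>C" "(x * y, x' * y') \<in> \<Union>C"
    using partial_iso_diff partial_iso_mult assms(2) by blast+
qed (use assms(2) partial_iso_zero_iff in blast)+

lemma countable_converse [simp]: "countable (r\<inverse>) \<longleftrightarrow> countable r"
proof -
  have "r\<inverse> = prod.swap ` r" "r = prod.swap ` (r\<inverse>)"
    by force+
  then show ?thesis by (metis countable_image)
qed

lemma countable_polys:
  assumes "countable (Q :: complex set)"
  shows "countable {q. range (coeff q) \<subseteq> Q}"
proof (rule countable_subset)
  show "{q. range (coeff q) \<subseteq> Q} \<subseteq> Poly ` lists Q"
  proof
    fix q assume "q \<in> {q. range (coeff q) \<subseteq> Q}"
    then have "set (coeffs q) \<subseteq> Q" using range_coeff[of q] by auto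
    then show "q \<in> Poly ` lists Q" by (intro image_eqI[of _ _ "coeffs q"]) auto
  qed
qed (use assms in auto)

lemma countable_adjoin:
  assumes "countable r" shows "countable (adjoin r t t')"
proof -
  have "poly_pairs r \<subseteq> {q. range (coeff q) \<subseteq> Domain r} \<times> {q. range (coeff q) \<subseteq> Range r}"
    unfolding poly_pairs_def by auto
  moreover have "countable (Domain r)" "countable (Range r)"
    using assms by (auto simp: Domain_fst Range_snd)
  ultimately have "countable (poly_pairs r)"
    using countable_polys by (meson countable_SIGMA countable_subset)
  then show ?thesis unfolding adjoin_def by auto
qed

text \<open>Countably many nonzero polynomials have only countably many roots, and \<complex> is
  uncountable.\<close>

lemma transcendental_exists:
  assumes "countable (Q :: complex set)"
  obtains t where "\<And>q. q \<noteq> 0 \<Longrightarrow> range (coeff q) \<subseteq> Q \<Longrightarrow> poly q t \<noteq> 0"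
proof -
  have "countable (\<Union>q\<in>{q. range (coeff q) \<subseteq> Q} - {0}. {t. poly q t = 0})"
    using countable_polys[OF assms] by (intro countable_UN) (auto simp: poly_roots_finite countable_finite)
  then have "(\<Union>q\<in>{q. range (coeff q) \<subseteq> Q} - {0}. {t. poly q t = 0}) \<noteq> UNIV"
    using uncountable_UNIV_complex by metis
  then obtain t where "t \<notin> (\<Union>q\<in>{q. range (coeff q) \<subseteq> Q} - {0}. {t. poly q t = 0})" by blast
  then show ?thesis using that[of t] by simp
qed

text \<open>If z is algebraic over the domain, r itself will do. Otherwise z is adjoined with a
  partner that is transcendental over the range; such a partner exists because r is
  countable.\<close>

lemma capture_Domain:
  assumes r: "partial_iso r" "countable r"
  obtains r' where "partial_iso r'" "countable r'" "r \<subseteq> r'"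
    "\<And>Y. root_closed Y \<Longrightarrow> Domain r' \<subseteq> Y \<Longrightarrow> z \<in> Y"
proof (cases "\<exists>q. q \<noteq> 0 \<and> range (coeff q) \<subseteq> Domain r \<and> poly q z = 0")
  case True
  then have "z \<in> Y" if "root_closed Y" "Domain r \<subseteq> Y" for Y
    using that root_closed_root order_trans by metis
  then show ?thesis using that r by blast
next
  case False
  have "countable (Range r)" using r by (auto simp: Range_snd)
  then obtain t where t: "\<And>q. q \<noteq> 0 \<Longrightarrow> range (coeff q) \<subseteq> Range r \<Longrightarrow> poly q t \<noteq> 0"
    using transcendental_exists by blast
  have "poly q z = 0 \<longleftrightarrow> poly q' t = 0" if q: "(q, q') \<in> poly_pairs r" for q q'
  proof -
    have "range (coeff q) \<subseteq> Domain r" "range (coeff q') \<subseteq> Range r"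
      using q by (auto simp: poly_pairs_def)
    then show ?thesis using t[of q'] False poly_pairs_zero_iff[OF r(1) q] by auto
  qed
  then show ?thesis
    using that[of "adjoin r z t"] partial_iso_adjoin[OF r(1)] countable_adjoin[OF r(2)]
      subset_adjoin[OF r(1)] Domain_adjoin_subset_iff[OF r(1)] by blast
qed

text \<open>Capturing z for the domain of r and then for the domain of the converse relation serves
  both sides; the first capture persists because the relation only grows.\<close>

lemma capture:
  assumes r: "partial_iso r" "countable r"
  obtains r' where "partial_iso r'" "countable r'" "r \<subseteq> r'"
    "\<And>Y. root_closed Y \<Longrightarrow> Domain r' \<subseteq> Y \<or> Range r' \<subseteq> Y \<Longrightarrow> z \<in> Y"
proof -
  obtain r1 where 1: "partial_iso r1" "countable r1" "r \<subseteq> r1"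
    "\<And>Y. root_closed Y \<Longrightarrow> Domain r1 \<subseteq> Y \<Longrightarrow> z \<in> Y"
    using capture_Domain[OF r] by metis
  have "partial_iso (r1\<inverse>)" "countable (r1\<inverse>)" using 1 by simp_all
  then obtain r2 where 2: "partial_iso r2" "countable r2" "r1\<inverse> \<subseteq> r2"
    "\<And>Y. root_closed Y \<Longrightarrow> Domain r2 \<subseteq> Y \<Longrightarrow> z \<in> Y"
    using capture_Domain by metis
  show ?thesis
  proof (rule that[of "r2\<inverse>"])
    fix Y assume "root_closed Y" "Domain (r2\<inverse>) \<subseteq> Y \<or> Range (r2\<inverse>) \<subseteq> Y"
    moreover have "Range r1 \<subseteq> Domain r2" using Domain_mono[OF 2(3)] by simp
    moreover have "Domain r1 \<subseteq> Range r2" using Range_mono[OF 2(3)] by simp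
    ultimately show "z \<in> Y" using 1(4)[of Y] 2(4)[of Y] by auto
  qed (use 1 2 in auto)
qed

text \<open>One element of an enumeration of Z is captured per stage. The union of the stages
  captures all of them and is still countable.\<close>

lemma capture_set:
  assumes r: "partial_iso r" "countable r" and Z: "countable Z"
  obtains r' where "partial_iso r'" "countable r'" "r \<subseteq> r'"
    "\<And>Y. root_closed Y \<Longrightarrow> Domain r' \<subseteq> Y \<or> Range r' \<subseteq> Y \<Longrightarrow> Z \<subseteq> Y"
proof (cases "Z = {}")
  case False
  let ?P = "\<lambda>n s. partial_iso s \<and> countable s \<and> r \<subseteq> s"
  let ?Q = "\<lambda>n s s'. s \<subseteq> s' \<and> (\<forall>Y. root_closed Y \<longrightarrow> Domain s' \<subseteq> Y \<or> Range s' \<subseteq> Y \<longrightarrow> from_nat_into Z n \<in> Y)"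
  have "\<exists>R. \<forall>n. ?P n (R n) \<and> ?Q n (R n) (R (Suc n))"
  proof (rule dependent_nat_choice)
    show "\<exists>s. ?P 0 s" using r by blast
    show "\<exists>s'. ?P (Suc n) s' \<and> ?Q n s s'" if s: "?P n s" for s n
    proof -
      obtain s' where "partial_iso s'" "countable s'" "s \<subseteq> s'"
        "\<And>Y. root_closed Y \<Longrightarrow> Domain s' \<subseteq> Y \<or> Range s' \<subseteq> Y \<Longrightarrow> from_nat_into Z n \<in> Y"
        using capture[of s "from_nat_into Z n"] s by metis
      then show ?thesis using s by (intro exI[of _ s']) auto
    qed
  qed
  then obtain R where *: "\<forall>n. ?P n (R n) \<and> ?Q n (R n) (R (Suc n))" by (rule exE)
  note R = *[THEN spec, THEN conjunct1] *[THEN spec, THEN conjunct2]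
  have "R n \<subseteq> R (Suc n)" for n using R(2)[of n] by blast
  then have mono: "R m \<subseteq> R n" if "m \<le> n" for m n
    using lift_Suc_mono_le[of R] that by blast
  show ?thesis
  proof (rule that[of "\<Union>(range R)"])
    show "partial_iso (\<Union>(range R))"
    proof (rule partial_iso_Union)
      show "partial_iso s" if "s \<in> range R" for s using that R(1) by blast
      show "s \<subseteq> s' \<or> s' \<subseteq> s" if "s \<in> range R" "s' \<in> range R" for s s'
        using that mono by (metis imageE nat_le_linear)
    qed simp
    fix Y assume Y: "root_closed Y" "Domain (\<Union>(range R)) \<subseteq> Y \<or> Range (\<Union>(range R)) \<subseteq> Y"
    have "from_nat_into Z n \<in> Y" for n
    proof -
      have "Domain (R (Suc n)) \<subseteq> Y \<or> Range (R (Suc n)) \<subseteq> Y"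
        using Y(2) by (auto simp: Domain_Union Range_Union UN_subset_iff)
      then show ?thesis using R(2)[of n] Y(1) by metis
    qed
    then show "Z \<subseteq> Y" using subset_range_from_nat_into[OF Z] by blast
  qed (use R(1) in auto)
qed (use that r in auto)

text \<open>
  Domain and range generate the same algebraically closed subfield.  Unlike equality of
  transcendence degrees, this passes to unions of chains and forces a maximal partial isomorphism
  to be an automorphism.
\<close>

definition balanced :: "(complex \<times> complex) set \<Rightarrow> bool" where
  "balanced r \<longleftrightarrow> (\<forall>Y. root_closed Y \<longrightarrow> (Domain r \<subseteq> Y \<longleftrightarrow> Range r \<subseteq> Y))"

text \<open>Each stage captures the domain and the range of the preceding one. A root-closed set
  that contains one side of the union therefore contains both sides of every stage.\<close>

lemma balanced_extension:
  assumes r: "partial_iso r" "countable r"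
  obtains r' where "partial_iso r'" "balanced r'" "r \<subseteq> r'"
proof -
  let ?P = "\<lambda>n s. partial_iso s \<and> countable s \<and> r \<subseteq> s"
  let ?Q = "\<lambda>n s s'. s \<subseteq> s' \<and> (\<forall>Y. root_closed Y \<longrightarrow> Domain s' \<subseteq> Y \<or> Range s' \<subseteq> Y \<longrightarrow> Domain s \<union> Range s \<subseteq> Y)"
  have "\<exists>R. \<forall>n::nat. ?P n (R n) \<and> ?Q n (R n) (R (Suc n))"
  proof (rule dependent_nat_choice)
    show "\<exists>s. ?P 0 s" using r by blast
    show "\<exists>s'. ?P (Suc n) s' \<and> ?Q n s s'" if s: "?P n s" for s n
    proof -
      have "countable (Domain s \<union> Range s)" using s by (auto simp: Domain_fst Range_snd)
      then obtain s' where "partial_iso s'" "countable s'" "s \<subseteq> s'"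
        "\<And>Y. root_closed Y \<Longrightarrow> Domain s' \<subseteq> Y \<or> Range s' \<subseteq> Y \<Longrightarrow> Domain s \<union> Range s \<subseteq> Y"
        using capture_set[of s "Domain s \<union> Range s"] s by metis
      then show ?thesis using s by (intro exI[of _ s']) auto
    qed
  qed
  then obtain R where *: "\<forall>n. ?P n (R n) \<and> ?Q n (R n) (R (Suc n))" by (rule exE)
  note R = *[THEN spec, THEN conjunct1] *[THEN spec, THEN conjunct2]
  have "R n \<subseteq> R (Suc n)" for n using R(2)[of n] by blast
  then have mono: "R m \<subseteq> R n" if "m \<le> n" for m n
    using lift_Suc_mono_le[of R] that by blast
  show ?thesis
  proof (rule that[of "\<Union>(range R)"])
    show "partial_iso (\<Union>(range R))"
    proof (rule partial_iso_Union)
      show "partial_iso s" if "s \<in> range R" for s using that R(1) by blast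
      show "s \<subseteq> s' \<or> s' \<subseteq> s" if "s \<in> range R" "s' \<in> range R" for s s'
        using that mono by (metis imageE nat_le_linear)
    qed simp
    have both: "Domain (R n) \<union> Range (R n) \<subseteq> Y"
      if Y: "root_closed Y" "Domain (\<Union>(range R)) \<subseteq> Y \<or> Range (\<Union>(range R)) \<subseteq> Y" for n Y
    proof -
      have "Domain (R (Suc n)) \<subseteq> Y \<or> Range (R (Suc n)) \<subseteq> Y"
        using Y(2) by (auto simp: Domain_Union Range_Union UN_subset_iff)
      then show ?thesis using R(2)[of n] Y(1) by metis
    qed
    show "balanced (\<Union>(range R))"
      unfolding balanced_def
    proof (intro allI impI)
      fix Y assume Y: "root_closed Y"
      have "Domain (\<Union>(range R)) \<subseteq> Y \<longleftrightarrow> (\<forall>n. Domain (R n) \<subseteq> Y)"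
        "Range (\<Union>(range R)) \<subseteq> Y \<longleftrightarrow> (\<forall>n. Range (R n) \<subseteq> Y)"
        by (simp_all add: Domain_Union Range_Union UN_subset_iff)
      then show "Domain (\<Union>(range R)) \<subseteq> Y \<longleftrightarrow> Range (\<Union>(range R)) \<subseteq> Y"
        using both[OF Y] by (metis Un_subset_iff)
    qed
  qed (use R(1) in auto)
qed

lemma balanced_converse [simp]: "balanced (r\<inverse>) \<longleftrightarrow> balanced r"
  unfolding balanced_def by auto

text \<open>An algebraic t has a partner t' that is algebraic over the range, so
  \<open>adjoin r t t'\<close> has the same root-closed supersets on both sides as r. It stays
  balanced, and maximality shows that t was in the domain already.\<close>

lemma algebraic_step:
  assumes r: "partial_iso r" "balanced r"
    and max: "\<And>s. partial_iso s \<Longrightarrow> balanced s \<Longrightarrow> r \<subseteq> s \<Longrightarrow> s = r"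
  shows "root_closed (Domain r)"
  unfolding root_closed_def
proof (intro conjI allI impI ballI)
  show "1 \<in> Domain r" using partial_iso_one[OF r(1)] by blast
  show "x - y \<in> Domain r" "x * y \<in> Domain r" if "x \<in> Domain r" "y \<in> Domain r" for x y
    using that partial_iso_diff[OF r(1)] partial_iso_mult[OF r(1)] by blast+
  fix q t assume q: "q \<noteq> 0" "range (coeff q) \<subseteq> Domain r" "poly q t = 0"
  from algebraic_partner[OF r(1) this]
  obtain t' m m' where m: "(m, m') \<in> poly_pairs r" "m \<noteq> 0" "poly m' t' = 0"
    and transfer: "\<forall>q q'. (q, q') \<in> poly_pairs r \<longrightarrow> poly q t = 0 \<longleftrightarrow> poly q' t' = 0"
    by (elim exE conjE) (rule that)
  have "m' \<noteq> 0" using m poly_pairs_zero_iff[OF r(1)] by blast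
  moreover have "range (coeff m') \<subseteq> Range r" using m(1) by (auto simp: poly_pairs_def)
  ultimately have "t' \<in> Y" if "root_closed Y" "Range r \<subseteq> Y" for Y
    using that m(3) root_closed_root order_trans by metis
  moreover have "t \<in> Y" if "root_closed Y" "Domain r \<subseteq> Y" for Y
    using that q root_closed_root order_trans by metis
  ultimately have "balanced (adjoin r t t')"
    using r(2) unfolding balanced_def
    by (simp add: Domain_adjoin_subset_iff[OF r(1)] Range_adjoin_subset_iff[OF r(1)] cong: conj_cong imp_cong)
  then have "adjoin r t t' = r"
    using transfer by (intro max partial_iso_adjoin[OF r(1)] subset_adjoin[OF r(1)]) simp
  then show "t \<in> Domain r" using in_adjoin[OF r(1), of t t'] by auto
qed

lemma countable_partial_iso_extends:
  assumes "partial_iso r0" "countable r0"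
  obtains \<sigma> :: "complex \<Rightarrow> complex"
  where "bij \<sigma>" "\<sigma> 1 = 1" "\<And>x y. \<sigma> (x + y) = \<sigma> x + \<sigma> y" "\<And>x y. \<sigma> (x * y) = \<sigma> x * \<sigma> y"
    "\<And>x y. (x, y) \<in> r0 \<Longrightarrow> \<sigma> x = y"
proof -
  obtain r1 where r1: "partial_iso r1" "balanced r1" "r0 \<subseteq> r1"
    using balanced_extension[OF assms] .
  define A where "A = {r. partial_iso r \<and> balanced r \<and> r1 \<subseteq> r}"
  have "\<exists>M\<in>A. \<forall>Q\<in>A. M \<subseteq> Q \<longrightarrow> Q = M"
  proof (rule subset_Zorn_nonempty)
    show "A \<noteq> {}" using r1 by (auto simp: A_def)
    fix C assume C: "C \<noteq> {}" "subset.chain A C"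
    then have sub: "C \<subseteq> A" and lin: "\<And>r s. r \<in> C \<Longrightarrow> s \<in> C \<Longrightarrow> r \<subseteq> s \<or> s \<subseteq> r"
      by (auto simp: subset_chain_def)
    have piC: "partial_iso r" and balC: "balanced r" if "r \<in> C" for r
      using sub that by (auto simp: A_def)
    have "partial_iso (\<Union>C)" using C(1) piC lin by (rule partial_iso_Union)
    \<comment> \<open>Containment of a union in Y can be tested member by member, on either
      side.\<close>
    moreover have "balanced (\<Union>C)"
      unfolding balanced_def Domain_Union Range_Union UN_subset_iff
      using balC unfolding balanced_def by simp
    moreover have "r1 \<subseteq> \<Union>C" using C(1) sub by (auto simp: A_def)
    ultimately show "\<Union>C \<in> A" by (simp add: A_def)
  qed
  then obtain r where rA: "r \<in> A" and rmax: "\<And>s. s \<in> A \<Longrightarrow> r \<subseteq> s \<Longrightarrow> s = r" by blast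
  then have r: "partial_iso r" "balanced r" "r1 \<subseteq> r" by (auto simp: A_def)
  have max: "s = r" if "partial_iso s" "balanced s" "r \<subseteq> s" for s
    using that r(3) by (intro rmax) (auto simp: A_def)
  have rc: "root_closed (Domain r)" using algebraic_step[OF r(1,2) max] .
  have "root_closed (Domain (r\<inverse>))"
  proof (rule algebraic_step)
    fix s assume "partial_iso s" "balanced s" "r\<inverse> \<subseteq> s"
    then have "s\<inverse> = r" by (intro max) auto
    then show "s = r\<inverse>" by auto
  qed (use r in auto)
  \<comment> \<open>Both sides are now root-closed, so each may serve as Y in
    \<open>balanced\<close> and contains the other.\<close>
  then have eq: "Range r = Domain r"
    using rc r(2) unfolding balanced_def by (metis Domain_converse order_antisym order_refl)
  have dom: "Domain r = UNIV"
  proof (rule ccontr)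
    assume "Domain r \<noteq> UNIV"
    then obtain t where t: "t \<notin> Domain r" by blast
    have nz: "poly q t = 0 \<longleftrightarrow> q = 0" if "range (coeff q) \<subseteq> Domain r" for q
      using root_closed_root[OF rc _ that] t by auto
    \<comment> \<open>A missing t is transcendental over the common field and can be its own
      partner. Adding the same element on both sides keeps the balance, which an arbitrary
      transcendental partner would in general destroy.\<close>
    have "poly q t = 0 \<longleftrightarrow> poly q' t = 0" if q: "(q, q') \<in> poly_pairs r" for q q'
    proof -
      have "range (coeff q) \<subseteq> Domain r" "range (coeff q') \<subseteq> Range r"
        using q by (auto simp: poly_pairs_def)
      then show ?thesis using nz poly_pairs_zero_iff[OF r(1) q] eq by auto
    qed
    from partial_iso_adjoin[OF r(1) this]
    have "adjoin r t t = r"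
      using r Domain_adjoin_subset_iff[OF r(1)] Range_adjoin_subset_iff[OF r(1)]
      by (intro max subset_adjoin[OF r(1)]) (simp_all add: balanced_def)
    then show False using in_adjoin[OF r(1), of t t] t by auto
  qed
  define \<sigma> where "\<sigma> x = (SOME y. (x, y) \<in> r)" for x
  have s: "(x, \<sigma> x) \<in> r" for x
    using dom someI_ex[of "\<lambda>y. (x, y) \<in> r"] unfolding \<sigma>_def by auto
  have s_eq: "\<sigma> x = y" if "(x, y) \<in> r" for x y
    using partial_iso_eq_iff[OF r(1) s[of x] that] by simp
  show ?thesis
  proof (rule that[of \<sigma>])
    show "bij \<sigma>"
    proof (rule bijI)
      show "inj \<sigma>" using partial_iso_eq_iff[OF r(1) s s] by (auto intro: injI)
      have "y \<in> range \<sigma>" for y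
      proof -
        have "y \<in> Range r" using eq dom by simp
        then show ?thesis using s_eq by blast
      qed
      then show "surj \<sigma>" by blast
    qed
  qed (use r(1,3) r1(3) in \<open>auto intro!: s_eq partial_iso_one partial_iso_add partial_iso_mult s\<close>)
qed

section \<open>Characters of countable commutative monoids\<close>

definition is_ideal :: "'a::comm_ring_1 set \<Rightarrow> bool" where
  "is_ideal I \<longleftrightarrow> 0 \<in> I \<and> (\<forall>x\<in>I. \<forall>y\<in>I. x + y \<in> I) \<and> (\<forall>x\<in>I. \<forall>y. y * x \<in> I)"

text \<open>The last property of M says that the residue ring is a field. It is phrased through
  inverses modulo M so that the quotient never has to be formed.\<close>

lemma maximal_ideal_exists:
  fixes I :: "'a::comm_ring_1 set"
  assumes "is_ideal I" "1 \<notin> I"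
  obtains M where "is_ideal M" "1 \<notin> M" "I \<subseteq> M" "\<And>x. x \<notin> M \<Longrightarrow> \<exists>y. y * x - 1 \<in> M"
proof -
  define A where "A = {J. is_ideal J \<and> 1 \<notin> J \<and> I \<subseteq> J}"
  have "\<exists>M\<in>A. \<forall>J\<in>A. M \<subseteq> J \<longrightarrow> J = M"
  proof (rule subset_Zorn_nonempty)
    show "A \<noteq> {}" using assms by (auto simp: A_def)
    fix C assume C: "C \<noteq> {}" "subset.chain A C"
    then have sub: "C \<subseteq> A" and lin: "\<And>r s. r \<in> C \<Longrightarrow> s \<in> C \<Longrightarrow> r \<subseteq> s \<or> s \<subseteq> r"
      by (auto simp: subset_chain_def)
    have "is_ideal (\<Union>C)"
      unfolding is_ideal_def
    proof (intro conjI ballI allI)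
      show "0 \<in> \<Union>C" using C(1) sub by (auto simp: A_def is_ideal_def)
      show "x + y \<in> \<Union>C" if xy: "x \<in> \<Union>C" "y \<in> \<Union>C" for x y
      proof -
        obtain J where "J \<in> C" "x \<in> J" "y \<in> J" using lin xy by blast
        then show ?thesis using sub unfolding A_def is_ideal_def by blast
      qed
      show "y * x \<in> \<Union>C" if "x \<in> \<Union>C" for x y
        using that sub unfolding A_def is_ideal_def by blast
    qed
    then show "\<Union>C \<in> A" using C(1) sub by (auto simp: A_def)
  qed
  then obtain M where MA: "M \<in> A" and Mmax: "\<And>J. J \<in> A \<Longrightarrow> M \<subseteq> J \<Longrightarrow> J = M" by blast
  then have M: "is_ideal M" "1 \<notin> M" "I \<subseteq> M" by (auto simp: A_def)
  have max: "J = M" if "is_ideal J" "1 \<notin> J" "M \<subseteq> J" for J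
    using that M(3) by (intro Mmax) (auto simp: A_def)
  have M': "0 \<in> M" "\<And>x y. x \<in> M \<Longrightarrow> y \<in> M \<Longrightarrow> x + y \<in> M" "\<And>x y. x \<in> M \<Longrightarrow> y * x \<in> M"
    using M(1) unfolding is_ideal_def by auto
  have "\<exists>y. y * x - 1 \<in> M" if x: "x \<notin> M" for x
  proof -
    define J where "J = {m + y * x | m y. m \<in> M}"
    have J: "m + y * x \<in> J" if "m \<in> M" for m y using that unfolding J_def by blast
    have "is_ideal J"
      unfolding is_ideal_def
    proof (intro conjI ballI allI)
      show "0 \<in> J" using J[OF M'(1), of 0] by simp
      show "u + v \<in> J" if uv: "u \<in> J" "v \<in> J" for u v
      proof -
        obtain m y m' y' where *: "m \<in> M" "m' \<in> M" "u = m + y * x" "v = m' + y' * x"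
          using uv unfolding J_def by blast
        have "u + v = (m + m') + (y + y') * x" by (simp add: * algebra_simps)
        then show ?thesis using J[OF M'(2)[OF *(1,2)]] by simp
      qed
      show "v * u \<in> J" if u: "u \<in> J" for u v
      proof -
        obtain m y where *: "m \<in> M" "u = m + y * x" using u unfolding J_def by blast
        have "v * u = v * m + (v * y) * x" by (simp add: * algebra_simps)
        then show ?thesis using J[OF M'(3)[OF *(1)]] by simp
      qed
    qed
    moreover have "M \<subseteq> J" using J[of _ 0] by auto
    moreover have "x \<in> J" using J[OF M'(1), of 1] by simp
    ultimately have "1 \<in> J" using max x by metis
    then obtain m y where *: "m \<in> M" "1 = m + y * x" unfolding J_def by blast
    have "y * x - 1 = (-1) * m" using *(2) by (simp add: algebra_simps)
    then show ?thesis using M'(3)[OF *(1)] by metis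
  qed
  then show ?thesis using that[OF M] by metis
qed

text \<open>A countable spanning set exhausts the space by finite-dimensional subspaces, one for
  each initial segment of an enumeration. An independent set meets each of them in finitely many
  vectors and is therefore countable.\<close>

lemma uncountable_imp_dependent:
  fixes scale :: "complex \<Rightarrow> 'a::ab_group_add \<Rightarrow> 'a" and u :: "complex \<Rightarrow> 'a"
  assumes "vector_space scale" and B: "countable B" "module.span scale B = UNIV" and u: "inj u"
  obtains L c where "finite L" "(\<Sum>x\<in>L. scale (c x) (u x)) = 0" "\<exists>x\<in>L. c x \<noteq> 0"
proof -
  interpret vector_space scale by fact
  have "dependent (range u)"
  proof (rule ccontr)
    assume ind: "independent (range u)"
    define E where "E n = from_nat_into B ` {..n::nat} \<inter> B" for n
    have fin: "finite (E n)" for n by (simp add: E_def)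
    have "x \<in> (\<Union>n. range u \<inter> span (E n))" if x: "x \<in> range u" for x
    proof -
      have "x \<in> span B" using B by simp
      then obtain t c where t: "finite t" "t \<subseteq> B" "x = (\<Sum>a\<in>t. scale (c a) a)"
        unfolding span_explicit by auto
      then have t3: "x \<in> span t" by (simp only: span_sum span_scale span_base)
      have "t \<subseteq> E (Max (to_nat_on B ` t))"
      proof
        fix b assume b: "b \<in> t"
        then have "b = from_nat_into B (to_nat_on B b)" using t B by auto
        then show "b \<in> E (Max (to_nat_on B ` t))"
          using b t unfolding E_def by auto
      qed
      then show ?thesis using t3 x span_mono by blast
    qed
    then have "range u \<subseteq> (\<Union>n. range u \<inter> span (E n))" by blast
    moreover have "finite (range u \<inter> span (E n))" for n
      using independent_span_bound[OF fin independent_mono[OF ind], of "range u \<inter> span (E n)" n] by auto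
    then have "countable (\<Union>n. range u \<inter> span (E n))" by (intro countable_UN) (auto intro: countable_finite)
    ultimately have "countable (range u)" using countable_subset by blast
    then have "countable (UNIV :: complex set)" using u by (rule countable_image_inj_on)
    then show False using uncountable_UNIV_complex by blast
  qed
  then obtain t c where t: "finite t" "t \<subseteq> range u" "(\<Sum>v\<in>t. scale (c v) v) = 0" "\<exists>v\<in>t. c v \<noteq> 0"
    unfolding dependent_explicit by blast
  show ?thesis
  proof (rule that[of "u -` t" "c \<circ> u"])
    show "finite (u -` t)" using t(1) u by (rule finite_vimageI)
    have "(\<Sum>x\<in>u -` t. scale ((c \<circ> u) x) (u x)) = (\<Sum>v\<in>u ` (u -` t). scale (c v) v)"
      by (subst sum.reindex) (auto intro: inj_on_subset[OF u])
    also have "u ` (u -` t) = t" using t(2) by auto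
    finally show "(\<Sum>x\<in>u -` t. scale ((c \<circ> u) x) (u x)) = 0" using t(3) by simp
    show "\<exists>x\<in>u -` t. (c \<circ> u) x \<noteq> 0" using t(2,4) by (metis comp_apply imageE subsetD vimageI)
  qed
qed

text \<open>The map h embeds the scalars, and e is reduction modulo a maximal ideal M above I: e t
  is the scalar l with t - h l in M. Countable dimension enters through the existence of l;
  uniqueness holds because a nonzero scalar is a unit.\<close>

lemma countable_dim_nullstellensatz:
  fixes h :: "complex \<Rightarrow> 'a::comm_ring_1"
  assumes h: "h 1 = 1" "\<And>x y. h (x + y) = h x + h y" "\<And>x y. h (x * y) = h x * h y"
    and B: "countable B" "module.span (\<lambda>z x. h z * x) B = UNIV"
    and I: "is_ideal I" "1 \<notin> I"
  obtains e where "\<And>z. e (h z) = z" "\<And>x y. e (x + y) = e x + e y" "\<And>x y. e (x * y) = e x * e y"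
    "\<And>x. x \<in> I \<Longrightarrow> e x = 0"
proof -
  obtain M where M: "is_ideal M" "1 \<notin> M" "I \<subseteq> M" and inv: "\<And>x. x \<notin> M \<Longrightarrow> \<exists>y. y * x - 1 \<in> M"
    using maximal_ideal_exists[OF I] by blast
  have M0: "0 \<in> M" and Madd: "\<And>x y. x \<in> M \<Longrightarrow> y \<in> M \<Longrightarrow> x + y \<in> M"
    and Mmult: "\<And>x y. x \<in> M \<Longrightarrow> y * x \<in> M"
    using M(1) unfolding is_ideal_def by auto
  have Mneg: "- x \<in> M" if "x \<in> M" for x using Mmult[OF that, of "-1"] by simp
  have Mdiff: "x - y \<in> M" if "x \<in> M" "y \<in> M" for x y using Madd[OF that(1) Mneg[OF that(2)]] by simp
  have Msum: "sum f A \<in> M" if "\<And>i. i \<in> A \<Longrightarrow> f i \<in> M" for f and A :: "complex set"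
    using that by (induction A rule: infinite_finite_induct) (auto intro: Madd M0)
  have prime: "y \<in> M" if "x * y \<in> M" "x \<notin> M" for x y
  proof -
    obtain z where z: "z * x - 1 \<in> M" using inv \<open>x \<notin> M\<close> by blast
    have "y = z * (x * y) - y * (z * x - 1)" by (simp add: algebra_simps)
    then show ?thesis using Mdiff[OF Mmult[OF that(1)] Mmult[OF z]] by metis
  qed
  have h0: "h 0 = 0" using h(2)[of 0 0] by simp
  have hneg: "h (- x) = - h x" for x using h(2)[of x "-x"] h0 by (simp add: eq_neg_iff_add_eq_0 add.commute)
  have hdiff: "h (x - y) = h x - h y" for x y using h(2)[of x "-y"] hneg by simp
  have hM: "h z \<in> M \<longleftrightarrow> z = 0" for z
  proof
    show "z = 0" if "h z \<in> M"
    proof (rule ccontr)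
      assume "z \<noteq> 0"
      then have "h (inverse z) * h z = 1" using h(1) h(3)[of "inverse z" z] by simp
      then show False using Mmult[OF that, of "h (inverse z)"] M(2) by simp
    qed
  qed (use h0 M0 in simp)
  have vs: "vector_space (\<lambda>z x. h z * x)"
    by unfold_locales (simp_all add: h algebra_simps)
  have ex: "\<exists>l. t - h l \<in> M" for t
  proof (rule ccontr)
    assume none: "\<nexists>l. t - h l \<in> M"
    then have "\<forall>l. \<exists>y. y * (t - h l) - 1 \<in> M" using inv by blast
    then obtain u where u: "\<And>l. u l * (t - h l) - 1 \<in> M" by metis
    \<comment> \<open>If u l = u m with l and m distinct, subtracting the two congruences puts u l
      times a nonzero scalar into M, although u l is invertible modulo M.\<close>
    have "inj u"
    proof (rule injI, rule ccontr)
      fix l m assume eq: "u l = u m" "l \<noteq> m"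
      have "(u m * (t - h m) - 1) - (u l * (t - h l) - 1) = u l * h (l - m)"
        by (simp add: eq hdiff algebra_simps)
      then have "u l * h (l - m) \<in> M" using Mdiff[OF u u] by metis
      then have "u l \<in> M" using prime[of "h (l - m)" "u l"] hM eq(2) by (simp add: mult.commute)
      then have "(t - h l) * u l - (u l * (t - h l) - 1) \<in> M" by (intro Mdiff Mmult u)
      then show False using M(2) by (simp add: mult.commute)
    qed
    then obtain L c where L: "finite L" "(\<Sum>l\<in>L. h (c l) * u l) = 0" "\<exists>l\<in>L. c l \<noteq> 0"
      using uncountable_imp_dependent[OF vs B] by metis
    \<comment> \<open>Clearing denominators in the dependency gives a nonzero polynomial q with q(t) in M.\<close>
    define P where "P = (\<lambda>A. \<Prod>l\<in>A. t - h l)"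
    obtain l0 where l0: "l0 \<in> L" "c l0 \<noteq> 0" using L by blast
    define q where "q = (\<Sum>l\<in>L. smult (c l) (\<Prod>m\<in>L - {l}. [:- m, 1:]))"
    define ev where "ev = (\<lambda>q. poly (map_poly h q) t)"
    have ev_pCons: "ev (pCons a q) = h a + t * ev q" for a q
      using h0 by (cases "pCons a q = 0") (simp_all add: ev_def map_poly_pCons)
    have ev_0 [simp]: "ev 0 = 0" by (simp add: ev_def)
    have ev_add: "ev (p + q) = ev p + ev q" for p q
      by (induction p q rule: poly_induct2) (simp_all add: ev_pCons h algebra_simps)
    have ev_smult: "ev (smult a q) = h a * ev q" for a q
      by (induction q) (simp_all add: ev_pCons h algebra_simps)
    have ev_mult: "ev (p * q) = ev p * ev q" for p q
      by (induction p) (simp_all add: ev_pCons ev_add ev_smult h0 algebra_simps)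
    have ev_sum: "ev (sum f A) = (\<Sum>l\<in>A. ev (f l))" if "finite A" for f and A :: "complex set"
      using that by (induction A) (simp_all add: ev_add)
    have ev_1: "ev 1 = 1" by (simp add: ev_pCons h one_pCons)
    have ev_prod: "ev (\<Prod>m\<in>A. [:- m, 1:]) = P A" if "finite A" for A
      using that by (induction A) (simp_all add: ev_mult ev_pCons h hneg P_def ev_1 del: mult_pCons_left)
    have ev_q: "ev q = (\<Sum>l\<in>L. h (c l) * P (L - {l}))"
      unfolding q_def using L(1) by (simp add: ev_sum ev_smult ev_prod)
    have "ev q \<in> M"
    proof -
      \<comment> \<open>The subtracted term is zero by the dependency. It turns each summand into a
        multiple of u l * (t - h l) - 1, which lies in M.\<close>
      have "ev q = (\<Sum>l\<in>L. h (c l) * P (L - {l})) - P L * (\<Sum>l\<in>L. h (c l) * u l)"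
        by (simp add: ev_q L)
      also have "\<dots> = (\<Sum>l\<in>L. - (h (c l) * P (L - {l})) * (u l * (t - h l) - 1))"
        unfolding sum_distrib_left sum_subtractf[symmetric]
      proof (rule sum.cong)
        fix l assume "l \<in> L"
        then have "P L = (t - h l) * P (L - {l})" unfolding P_def using L(1) by (rule prod.remove[rotated])
        then show "h (c l) * P (L - {l}) - P L * (h (c l) * u l) = - (h (c l) * P (L - {l})) * (u l * (t - h l) - 1)"
          by (simp only:) (simp add: algebra_simps)
      qed simp
      also have "\<dots> \<in> M" by (intro Msum Mmult u)
      finally show ?thesis .
    qed
    moreover have "poly q l0 \<noteq> 0"
    proof -
      have "poly q l0 = (\<Sum>l\<in>L. c l * (\<Prod>m\<in>L - {l}. l0 - m))"
        by (simp add: q_def poly_sum poly_prod algebra_simps)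
      \<comment> \<open>For l other than l0 the product contains the factor l0 - l0.\<close>
      also have "\<dots> = c l0 * (\<Prod>m\<in>L - {l0}. l0 - m)"
        using L(1) l0(1) by (subst sum.remove[of L l0]) (auto intro!: sum.neutral)
      also have "\<dots> \<noteq> 0" using l0 L(1) by auto
      finally show ?thesis .
    qed
    then have "q \<noteq> 0" by auto
    \<comment> \<open>Over \<complex> the polynomial splits into a nonzero constant and linear
      factors. Each linear factor evaluates to some t - h z outside M, and M is prime.\<close>
    then have "ev q \<notin> M"
    proof (induction "degree q" arbitrary: q)
      case 0
      then obtain a where "q = [:a:]" "a \<noteq> 0" by (metis degree_eq_zeroE pCons_0_0)
      then show ?case using hM by (simp add: ev_pCons)
    next
      case (Suc n)
      then obtain z where "poly q z = 0" using alg_closed_imp_poly_has_root[of q] by auto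
      then obtain s where s: "q = [:- z, 1:] * s" by (auto simp: poly_eq_0_iff_dvd)
      with Suc.prems have "s \<noteq> 0" by auto
      moreover from this have "degree q = Suc (degree s)" unfolding s by (subst degree_mult_eq) auto
      ultimately have "ev s \<notin> M" using Suc.hyps by auto
      moreover have "ev [:- z, 1:] \<notin> M" using none h by (simp add: ev_pCons hneg)
      ultimately show ?case unfolding s ev_mult using prime by blast
    qed
    ultimately show False by blast
  qed
  have uniq: "l = m" if "t - h l \<in> M" "t - h m \<in> M" for t l m
    using Mdiff[OF that(2,1)] hM[of "l - m"] by (simp add: hdiff)
  define e where "e t = (SOME l. t - h l \<in> M)" for t
  have e: "t - h (e t) \<in> M" for t unfolding e_def using ex by (rule someI_ex)
  show ?thesis
  proof (rule that)
    show "e (h z) = z" for z using uniq[OF e, of "h z" z] M0 by simp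
    show "e (x + y) = e x + e y" for x y
      using Madd[OF e[of x] e[of y]] by (intro uniq[OF e]) (simp add: h algebra_simps)
    show "e (x * y) = e x * e y" for x y
      using Madd[OF Mmult[OF e[of x], of y] Mmult[OF e[of y], of "h (e x)"]]
      by (intro uniq[OF e]) (simp add: h algebra_simps)
    show "e x = 0" if "x \<in> I" for x
      using that M(3) h0 by (intro uniq[OF e]) auto
  qed
qed

text \<open>A relation satisfied by all translates of G is an element of the monoid algebra that
  annihilates G. A character of the algebra that kills all these elements, evaluated at the
  monomials, inherits the relations. Relations are indexed by sets of naturals because an obtained
  fact cannot quantify over an index type.\<close>

lemma spectral_analysis:
  fixes G :: "'m::comm_monoid_add \<Rightarrow> complex"
  assumes cnt: "countable (UNIV :: 'm set)" and G: "G m0 \<noteq> 0"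
  obtains \<xi> where "\<xi> 0 = 1" "\<And>m n. \<xi> (m + n) = \<xi> m * \<xi> n"
    "\<And>(A :: nat set) (B :: nat set) c d g h. finite A \<Longrightarrow> finite B \<Longrightarrow>
       (\<And>m. (\<Sum>i\<in>A. c i * G (g i + m)) = (\<Sum>i\<in>B. d i * G (h i + m))) \<Longrightarrow>
       (\<Sum>i\<in>A. c i * \<xi> (g i)) = (\<Sum>i\<in>B. d i * \<xi> (h i))"
proof -
  \<comment> \<open>The linear extension of G from monomials to the whole monoid algebra.\<close>
  define L :: "('m \<Rightarrow>\<^sub>0 complex) \<Rightarrow> complex" where "L r = (\<Sum>m\<in>Poly_Mapping.keys r. Poly_Mapping.lookup r m * G m)" for r
  have L_superset: "L r = (\<Sum>m\<in>A. Poly_Mapping.lookup r m * G m)" if "finite A" "Poly_Mapping.keys r \<subseteq> A" for r A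
    unfolding L_def using that
    by (intro sum.mono_neutral_left) (auto simp: lookup_eq_zero_in_keys_contradict Poly_Mapping.not_in_keys_iff_lookup_eq_zero[THEN iffD1])
  have L_add: "L (r + s) = L r + L s" for r s
    using Poly_Mapping.keys_add[of r s]
    by (subst (1 2 3) L_superset[of "Poly_Mapping.keys r \<union> Poly_Mapping.keys s"]) (auto simp: lookup_add algebra_simps sum.distrib)
  have L_0: "L 0 = 0" by (simp add: L_def)
  note L_sum = sum_comp_morphism[of L, OF L_0 L_add, unfolded o_def, symmetric]
  have L_single: "L (Poly_Mapping.single m z) = z * G m" for m z
    by (subst L_superset[of "{m}"]) auto
  define h :: "complex \<Rightarrow> ('m \<Rightarrow>\<^sub>0 complex)" where "h z = Poly_Mapping.single 0 z" for z
  define mon :: "'m \<Rightarrow> ('m \<Rightarrow>\<^sub>0 complex)" where "mon m = Poly_Mapping.single m 1" for m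
  have h_mon: "h z * mon m = Poly_Mapping.single m z" for z m by (simp add: h_def mon_def mult_single)
  have decomp: "r = (\<Sum>m\<in>Poly_Mapping.keys r. h (Poly_Mapping.lookup r m) * mon m)" for r
    unfolding h_mon by (rule poly_mapping_eqI) (auto simp: lookup_sum lookup_single when_def in_keys_iff)
  have L_h: "L (h z * r) = z * L r" for z r
  proof -
    have "h z * r = (\<Sum>m\<in>Poly_Mapping.keys r. Poly_Mapping.single m (z * Poly_Mapping.lookup r m))"
      by (subst (2) decomp, subst h_mon) (simp add: sum_distrib_left h_def mult_single)
    then show ?thesis by (simp add: L_sum L_single) (simp add: L_def sum_distrib_left mult.assoc)
  qed
  \<comment> \<open>The largest ideal contained in the kernel of L.\<close>
  define I where "I = {r. \<forall>s. L (s * r) = 0}"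
  have I: "is_ideal I"
    unfolding is_ideal_def I_def by (auto simp: L_0 L_add distrib_left simp flip: mult.assoc)
  have "1 \<notin> I"
  proof
    assume "1 \<in> I"
    then have "L (mon m0 * 1) = 0" unfolding I_def by blast
    then show False using G by (simp add: mon_def L_single)
  qed
  have h: "h 1 = 1" "\<And>x y. h (x + y) = h x + h y" "\<And>x y. h (x * y) = h x * h y"
    by (simp_all add: h_def single_add mult_single)
  interpret V: vector_space "\<lambda>z r. h z * r"
    by unfold_locales (simp_all add: h algebra_simps)
  have "r \<in> V.span (range mon)" for r
    by (subst decomp) (intro V.span_sum V.span_scale V.span_base rangeI)
  then have span: "V.span (range mon) = UNIV" by blast
  have countable_mon: "countable (range mon)" using cnt by blast
  obtain e where e: "\<And>z. e (h z) = z" "\<And>x y. e (x + y) = e x + e y"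
    "\<And>x y. e (x * y) = e x * e y" "\<And>x. x \<in> I \<Longrightarrow> e x = 0"
    using countable_dim_nullstellensatz[OF h countable_mon span I \<open>1 \<notin> I\<close>] by blast
  have e_0: "e 0 = 0" using e(1)[of 0] by (simp add: h_def)
  note e_sum = sum_comp_morphism[of e, OF e_0 e(2), unfolded o_def, symmetric]
  have e_diff: "e (x - y) = e x - e y" for x y using e(2)[of "x - y" y] by simp
  show ?thesis
  proof (rule that[of "\<lambda>m. e (mon m)"])
    show "e (mon 0) = 1" using e(1)[of 1] by (simp add: h_def mon_def)
    show "e (mon (m + n)) = e (mon m) * e (mon n)" for m n by (simp add: mon_def mult_single flip: e)
    fix A B :: "nat set" and c d g h'
    assume "finite A" "finite B" and rel: "\<And>m. (\<Sum>i\<in>A. c i * G (g i + m)) = (\<Sum>i\<in>B. d i * G (h' i + m))"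
    define r where "r = (\<Sum>i\<in>A. h (c i) * mon (g i)) - (\<Sum>i\<in>B. h (d i) * mon (h' i))"
    have "L (s * r) = 0" for s
    proof -
      have "L (mon m * r) = 0" for m
      proof -
        have eq: "mon m * (\<Sum>i\<in>A. h (c i) * mon (g i)) = (\<Sum>i\<in>A. Poly_Mapping.single (g i + m) (c i))"
          for A :: "nat set" and c g
          unfolding h_mon by (simp add: mon_def sum_distrib_left mult_single add.commute)
        have "L (mon m * r) + L (mon m * (\<Sum>i\<in>B. h (d i) * mon (h' i))) = L (mon m * (\<Sum>i\<in>A. h (c i) * mon (g i)))"
          by (simp add: r_def algebra_simps flip: L_add)
        then show ?thesis unfolding eq using rel by (simp add: L_sum L_single)
      qed
      moreover have "s * r = (\<Sum>m\<in>Poly_Mapping.keys s. h (Poly_Mapping.lookup s m) * (mon m * r))"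
        by (subst (1) decomp) (simp add: sum_distrib_right mult.assoc)
      ultimately show ?thesis by (simp add: L_sum L_h)
    qed
    then have "e r = 0" by (intro e(4)) (simp add: I_def)
    then show "(\<Sum>i\<in>A. c i * e (mon (g i))) = (\<Sum>i\<in>B. d i * e (mon (h' i)))"
      unfolding r_def by (simp add: e_diff e_sum e)
  qed
qed

section \<open>Polarization\<close>

text \<open>Toggling the membership of j is a sign-reversing involution of the index set, so the sum
  equals its own negative.\<close>

lemma sum_alternating_supersets:
  fixes P S :: "'i set"
  assumes "finite P" "j \<in> P" "j \<notin> S"
  shows "(\<Sum>T\<in>{T \<in> Pow P. S \<subseteq> T}. (-1) ^ card T) = (0 :: complex)"
proof -
  define \<tau> where "\<tau> T = (if j \<in> T then T - {j} else insert j T)" for T :: "'i set"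
  let ?D = "{T \<in> Pow P. S \<subseteq> T}"
  have "(\<Sum>T\<in>?D. (-1) ^ card T) = (\<Sum>T\<in>?D. - ((-1 :: complex) ^ card T))"
  proof (rule sum.reindex_bij_witness[of _ \<tau> \<tau>])
    fix T assume T: "T \<in> ?D"
    then have fin: "finite T" using assms(1) finite_subset by auto
    show "\<tau> (\<tau> T) = T" by (auto simp: \<tau>_def)
    show "\<tau> T \<in> ?D" using T assms by (auto simp: \<tau>_def)
    have "- ((-1 :: complex) ^ card (\<tau> T)) = (-1) ^ card T"
    proof (cases "j \<in> T")
      case True
      then have "card T = Suc (card (T - {j}))" by (rule card_Suc_Diff1[OF fin, symmetric])
      then have "(-1 :: complex) ^ card T = - ((-1) ^ card (T - {j}))" by (metis power_Suc mult_minus1)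
      then show ?thesis using True by (simp add: \<tau>_def)
    qed (use fin in \<open>simp add: \<tau>_def\<close>)
    then show "- ((-1 :: complex) ^ card (\<tau> T)) = (-1) ^ card T" .
  qed (auto simp: \<tau>_def assms)
  then have "2 * (\<Sum>T\<in>?D. (-1 :: complex) ^ card T) = 0" by (simp add: sum_negf)
  then show ?thesis by simp
qed

text \<open>Multiplying out gives one summand for each choice s of a term in every argument of A.
  The remaining arguments w are arbitrary because the induction moves the chosen term of the next
  argument into w.\<close>

lemma multiadditive_expand:
  fixes H :: "('i \<Rightarrow> 'g::comm_monoid_add) \<Rightarrow> complex"
  assumes add: "\<And>w j u v. j \<in> P \<Longrightarrow> H (w(j := u + v)) = H (w(j := u)) + H (w(j := v))"
    and T: "finite T" and A: "finite A" "A \<subseteq> P"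
  shows "H (\<lambda>k. if k \<in> A then \<Sum>t\<in>T. z t else w k) =
    (\<Sum>s\<in>A \<rightarrow>\<^sub>E T. H (\<lambda>k. if k \<in> A then z (s k) else w k))"
  using A
proof (induction A arbitrary: w rule: finite_induct)
  case (insert j A)
  have sum: "H (w(j := \<Sum>t\<in>T. z t)) = (\<Sum>t\<in>T. H (w(j := z t)))" for w
  proof -
    have "H (w(j := 0)) = 0" using add[of j w 0 0] insert.prems by simp
    with T show ?thesis
      by (induction T rule: finite_induct) (use add insert.prems in simp_all)
  qed
  have "H (\<lambda>k. if k \<in> insert j A then \<Sum>t\<in>T. z t else w k) =
      H ((\<lambda>k. if k \<in> A then \<Sum>t\<in>T. z t else w k)(j := \<Sum>t\<in>T. z t))"
    by (intro arg_cong[of _ _ H]) auto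
  also have "\<dots> = (\<Sum>t\<in>T. H (\<lambda>k. if k \<in> A then \<Sum>t\<in>T. z t else (w(j := z t)) k))"
    unfolding sum using insert.hyps by (intro sum.cong refl arg_cong[of _ _ H]) auto
  also have "\<dots> = (\<Sum>t\<in>T. \<Sum>s\<in>A \<rightarrow>\<^sub>E T. H (\<lambda>k. if k \<in> A then z (s k) else (w(j := z t)) k))"
    using insert by (intro sum.cong refl insert.IH) auto
  also have "\<dots> = (\<Sum>(t, s)\<in>T \<times> (A \<rightarrow>\<^sub>E T). H (\<lambda>k. if k \<in> insert j A then z ((s(j := t)) k) else w k))"
    unfolding sum.cartesian_product using insert.hyps
    by (intro sum.cong refl) (auto intro!: arg_cong[of _ _ H])
  also have "\<dots> = (\<Sum>s\<in>insert j A \<rightarrow>\<^sub>E T. H (\<lambda>k. if k \<in> insert j A then z (s k) else w k))"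
    unfolding PiE_insert_eq using insert.hyps
    by (subst sum.reindex[OF inj_combinator]) (auto simp: case_prod_unfold)
  finally show ?case .
qed (auto simp: PiE_empty_domain)

text \<open>
  Expanding the alternating sum of H over the diagonal elements at the partial sums of z leaves
  only the bijective selections of arguments.
\<close>

lemma symmetric_multiadditive_eq_0:
  fixes H :: "('i \<Rightarrow> 'g::comm_monoid_add) \<Rightarrow> complex"
  assumes P: "finite P"
    and add: "\<And>w j u v. j \<in> P \<Longrightarrow> H (w(j := u + v)) = H (w(j := u)) + H (w(j := v))"
    and dep: "\<And>w w'. (\<And>k. k \<in> P \<Longrightarrow> w k = w' k) \<Longrightarrow> H w = H w'"
    and sym: "\<And>\<sigma> w. \<sigma> permutes P \<Longrightarrow> H (\<lambda>k. w (\<sigma> k)) = H w"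
    and diag: "\<And>x. H (\<lambda>k. x) = 0"
  shows "H z = 0"
proof -
  define h where "h s = H (\<lambda>k. z (s k))" for s
  define B where "B = {s \<in> P \<rightarrow>\<^sub>E P. s ` P = P}"
  have fin: "finite (P \<rightarrow>\<^sub>E P)" using P by (simp add: finite_PiE)
  have "(\<Sum>s\<in>P \<rightarrow>\<^sub>E T. h s) = 0" if "T \<subseteq> P" for T
  proof -
    have "finite T" using that P finite_subset by blast
    then have "H (\<lambda>k. if k \<in> P then \<Sum>t\<in>T. z t else \<Sum>t\<in>T. z t) =
        (\<Sum>s\<in>P \<rightarrow>\<^sub>E T. H (\<lambda>k. if k \<in> P then z (s k) else \<Sum>t\<in>T. z t))"
      by (intro multiadditive_expand[OF add _ P]) auto
    also have "\<dots> = (\<Sum>s\<in>P \<rightarrow>\<^sub>E T. h s)"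
      unfolding h_def by (intro sum.cong refl dep) auto
    finally show ?thesis using diag by simp
  qed
  then have "0 = (\<Sum>T\<in>Pow P. (-1) ^ card T * (\<Sum>s\<in>P \<rightarrow>\<^sub>E T. h s))" by simp
  \<comment> \<open>Selections with values in T are those whose image lies in T. In this form the
    range of s no longer depends on T, and the sums can be exchanged.\<close>
  also have "\<dots> = (\<Sum>T\<in>Pow P. \<Sum>s\<in>P \<rightarrow>\<^sub>E P. if s ` P \<subseteq> T then (-1) ^ card T * h s else 0)"
  proof (intro sum.cong refl)
    fix T assume T: "T \<in> Pow P"
    have "{s \<in> P \<rightarrow>\<^sub>E P. s ` P \<subseteq> T} = P \<rightarrow>\<^sub>E T"
      using T by (auto simp: PiE_iff image_subset_iff extensional_def)
    then show "(-1) ^ card T * (\<Sum>s\<in>P \<rightarrow>\<^sub>E T. h s) =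
        (\<Sum>s\<in>P \<rightarrow>\<^sub>E P. if s ` P \<subseteq> T then (-1) ^ card T * h s else 0)"
      using sum.inter_filter[OF fin, of "\<lambda>s. (-1) ^ card T * h s" "\<lambda>s. s ` P \<subseteq> T"]
      by (simp add: sum_distrib_left)
  qed
  also have "\<dots> = (\<Sum>s\<in>P \<rightarrow>\<^sub>E P. \<Sum>T\<in>Pow P. if s ` P \<subseteq> T then (-1) ^ card T * h s else 0)"
    by (rule sum.swap)
  also have "\<dots> = (\<Sum>s\<in>P \<rightarrow>\<^sub>E P. h s * (\<Sum>T\<in>{T \<in> Pow P. s ` P \<subseteq> T}. (-1) ^ card T))"
    unfolding sum_distrib_left
  proof (rule sum.cong[OF refl])
    fix s
    show "(\<Sum>T\<in>Pow P. if s ` P \<subseteq> T then (-1) ^ card T * h s else 0) =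
        (\<Sum>T\<in>{T \<in> Pow P. s ` P \<subseteq> T}. h s * (-1) ^ card T)"
      using P by (subst sum.inter_filter) (auto intro: sum.cong simp: mult.commute)
  qed
  also have "\<dots> = (\<Sum>s\<in>P \<rightarrow>\<^sub>E P. if s ` P = P then h s * (-1) ^ card P else 0)"
  proof (intro sum.cong refl)
    fix s assume s: "s \<in> P \<rightarrow>\<^sub>E P"
    show "h s * (\<Sum>T\<in>{T \<in> Pow P. s ` P \<subseteq> T}. (-1) ^ card T) =
        (if s ` P = P then h s * (-1) ^ card P else 0)"
    proof (cases "s ` P = P")
      case True
      then have "{T \<in> Pow P. s ` P \<subseteq> T} = {P}" by auto
      then show ?thesis using True by simp
    next
      case False
      then obtain j where "j \<in> P" "j \<notin> s ` P" using s by (auto simp: PiE_iff)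
      then show ?thesis using sum_alternating_supersets[OF P] False by simp
    qed
  qed
  also have "\<dots> = (\<Sum>s\<in>B. h s * (-1) ^ card P)"
    unfolding B_def using fin by (simp add: sum.inter_filter)
  \<comment> \<open>A surjective selection on the finite set P is a permutation, so by symmetry each
    remaining term equals H z.\<close>
  also have "\<dots> = (\<Sum>s\<in>B. H z * (-1) ^ card P)"
  proof (intro sum.cong refl)
    fix s assume s: "s \<in> B"
    define \<sigma> where "\<sigma> k = (if k \<in> P then s k else k)" for k
    have "\<sigma> ` P = P" using s by (auto simp: B_def \<sigma>_def)
    then have "bij_betw \<sigma> P P" using P by (simp add: bij_betw_def eq_card_imp_inj_on)
    then have "\<sigma> permutes P" by (rule bij_imp_permutes) (simp add: \<sigma>_def)
    then have "H (\<lambda>k. z (\<sigma> k)) = H z" by (rule sym)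
    moreover have "H (\<lambda>k. z (\<sigma> k)) = h s" unfolding h_def by (rule dep) (simp add: \<sigma>_def)
    ultimately show "h s * (-1) ^ card P = H z * (-1) ^ card P" by simp
  qed
  finally have "of_nat (card B) * H z = 0" by simp
  have "(\<lambda>k\<in>P. k) \<in> B" by (auto simp: B_def image_restrict_eq)
  moreover have "finite B" using fin by (simp add: B_def)
  ultimately have "card B \<noteq> 0" by auto
  with \<open>of_nat (card B) * H z = 0\<close> show ?thesis by simp
qed

lemma sum_Pow_card:
  fixes g :: "nat \<Rightarrow> 'a::comm_semiring_1"
  assumes "finite P"
  shows "(\<Sum>B\<in>Pow P. g (card B)) = (\<Sum>l=0..card P. of_nat (card P choose l) * g l)"
proof -
  have "(\<Sum>l=0..card P. \<Sum>B | B \<in> Pow P \<and> card B = l. g (card B)) = (\<Sum>B\<in>Pow P. g (card B))"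
    using assms by (intro sum.group) (auto intro: card_mono)
  moreover have "(\<Sum>B | B \<in> Pow P \<and> card B = l. g (card B)) = of_nat (card P choose l) * g l" for l
    using n_subsets[OF assms, of l] by simp
  ultimately show ?thesis by simp
qed

lemma prod_add_Pow:
  fixes f g :: "'i \<Rightarrow> complex"
  assumes "finite P"
  shows "(\<Prod>k\<in>P. f k + g k) = (\<Sum>B\<in>Pow P. \<Prod>k\<in>P. if k \<in> B then f k else g k)"
proof -
  have "(\<Prod>k\<in>P. if k \<in> B then f k else g k) = (\<Prod>k\<in>B. f k) * (\<Prod>k\<in>P - B. g k)" if "B \<in> Pow P" for B
    using assms that by (subst prod.If_cases) (auto simp: Int_absorb1 Diff_eq)
  then show ?thesis using prod_add[OF assms, of f g] by simp
qed

lemma prod_if_const: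
  fixes x y :: "'a::comm_monoid_mult"
  assumes "finite P" "B \<subseteq> P"
  shows "(\<Prod>k\<in>P. if k \<in> B then x else y) = x ^ card B * y ^ (card P - card B)"
proof -
  have "card (P \<inter> - B) = card P - card B"
    using assms by (metis card_Diff_subset diff_eq finite_subset)
  then show ?thesis using assms by (simp add: prod.If_cases Int_absorb1)
qed

lemma multiadditiveD:
  assumes "F \<in> multiadditive p K" "w \<in> tuples p K" "j \<in> {1..p}" "u \<in> K" "v \<in> K"
  shows "F (w(j := u + v)) = F (w(j := u)) + F (w(j := v))"
  using assms unfolding multiadditive_def by blast

lemma restrict_fun_upd_compose:
  "j \<in> P \<Longrightarrow> (\<lambda>k\<in>P. g ((z(j := u)) k)) = (\<lambda>k\<in>P. g (z k))(j := g u)"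
  by (auto simp: fun_eq_iff)

text \<open>Both sides are regarded as functions of p pairs. Their difference H is symmetric,
  additive in each pair and zero on the diagonal, hence zero everywhere; pairs with one vanishing
  component then isolate the set A.\<close>

lemma polarized_equation:
  fixes a \<alpha> \<beta> w :: "nat \<Rightarrow> complex"
  assumes F: "F \<in> multiadditive p UNIV"
    and sym: "\<And>\<sigma> w. \<sigma> permutes {1..p} \<Longrightarrow> w \<in> tuples p UNIV \<Longrightarrow> permute_args p \<sigma> F w = F w"
    and eq: "solves_on UNIV n a \<alpha> \<beta> p c (\<lambda>x. F (\<lambda>k\<in>{1..p}. x))"
    and A: "A \<subseteq> {1..p}"
  shows "(\<Sum>i=1..n. a i * F (\<lambda>k\<in>{1..p}. (if k \<in> A then \<alpha> i else \<beta> i) * w k)) =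
    c / of_nat (p choose card A) * (\<Prod>k=1..p. w k)"
proof -
  let ?P = "{1..p}"
  define g where "g i z = \<alpha> i * fst z + \<beta> i * snd z" for i and z :: "complex \<times> complex"
  define M where "M B z = (\<Prod>k\<in>?P. if k \<in> B then fst (z k) else snd (z k))"
    for B and z :: "nat \<Rightarrow> complex \<times> complex"
  \<comment> \<open>Dividing by the binomial coefficient spreads x^l y^(p-l) evenly over the sets of
    size l, so that the diagonal of R is the sum over l in the equation.\<close>
  define R where "R z = (\<Sum>B\<in>Pow ?P. M B z / of_nat (p choose card B))" for z
  define L where "L z = (\<Sum>i=1..n. a i * F (\<lambda>k\<in>?P. g i (z k)))" for z
  define H where "H z = L z - c * R z" for z
  have zero: "H z = 0" for z
  proof (rule symmetric_multiadditive_eq_0[of ?P H])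
    show "H w = H w'" if "\<And>k. k \<in> ?P \<Longrightarrow> w k = w' k" for w w'
    proof -
      have "(\<lambda>k\<in>?P. g i (w k)) = (\<lambda>k\<in>?P. g i (w' k))" for i using that by auto
      moreover have "M B w = M B w'" for B unfolding M_def using that by (intro prod.cong) auto
      ultimately show ?thesis by (simp add: H_def L_def R_def)
    qed
  next
    fix w j u v assume j: "j \<in> ?P"
    have "F (\<lambda>k\<in>?P. g i ((w(j := u + v)) k)) =
        F (\<lambda>k\<in>?P. g i ((w(j := u)) k)) + F (\<lambda>k\<in>?P. g i ((w(j := v)) k))" for i
    proof -
      have "g i (u + v) = g i u + g i v" by (simp add: g_def algebra_simps)
      then show ?thesis
        unfolding restrict_fun_upd_compose[OF j] by (simp add: multiadditiveD[OF F _ j])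
    qed
    then have "L (w(j := u + v)) = L (w(j := u)) + L (w(j := v))"
      by (simp add: L_def distrib_left sum.distrib)
    moreover have "M B (w(j := u + v)) = M B (w(j := u)) + M B (w(j := v))" for B
    proof -
      have "M B (w(j := x)) = (if j \<in> B then fst x else snd x) *
          (\<Prod>k\<in>?P - {j}. if k \<in> B then fst (w k) else snd (w k))" for x
      proof -
        have "(\<Prod>k\<in>?P - {j}. if k \<in> B then fst ((w(j := x)) k) else snd ((w(j := x)) k)) =
            (\<Prod>k\<in>?P - {j}. if k \<in> B then fst (w k) else snd (w k))"
          by (intro prod.cong) auto
        then show ?thesis
          unfolding M_def by (subst prod.remove[OF finite_atLeastAtMost j]) simp
      qed
      then show ?thesis by (simp add: distrib_right)
    qed
    then have "R (w(j := u + v)) = R (w(j := u)) + R (w(j := v))"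
      by (simp add: R_def add_divide_distrib sum.distrib)
    ultimately show "H (w(j := u + v)) = H (w(j := u)) + H (w(j := v))"
      by (simp add: H_def algebra_simps)
  next
    fix \<sigma> and w :: "nat \<Rightarrow> complex \<times> complex" assume \<sigma>: "\<sigma> permutes ?P"
    have "F (\<lambda>k\<in>?P. g i (w (\<sigma> k))) = F (\<lambda>k\<in>?P. g i (w k))" for i
    proof -
      have "(\<lambda>k\<in>?P. g i (w (\<sigma> k))) = (\<lambda>k\<in>?P. (\<lambda>k\<in>?P. g i (w k)) (\<sigma> k))"
        using permutes_in_image[OF \<sigma>] by (auto simp: fun_eq_iff)
      then show ?thesis using sym[OF \<sigma>, of "\<lambda>k\<in>?P. g i (w k)"] by (simp add: permute_args_def)
    qed
    then have "L (\<lambda>k. w (\<sigma> k)) = L w" by (simp add: L_def)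
    moreover have "R (\<lambda>k. w (\<sigma> k)) = R w"
    proof -
      have inj: "inj \<sigma>" using \<sigma> by (rule permutes_inj)
      have "M (\<sigma> ` B) w = M B (\<lambda>k. w (\<sigma> k))" for B
        unfolding M_def by (subst prod.permute[OF \<sigma>]) (simp add: inj_image_mem_iff[OF inj] o_def)
      moreover have "card (\<sigma> ` B) = card B" for B
        using inj by (simp add: card_image inj_on_subset)
      ultimately have "R (\<lambda>k. w (\<sigma> k)) = (\<Sum>B\<in>Pow ?P. M (\<sigma> ` B) w / of_nat (p choose card (\<sigma> ` B)))"
        by (simp add: R_def)
      also have "\<dots> = R w"
        unfolding R_def by (rule sum.reindex_bij_betw[OF bij_betw_Pow[OF permutes_imp_bij[OF \<sigma>]]])
      finally show ?thesis .
    qed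
    ultimately show "H (\<lambda>k. w (\<sigma> k)) = H w" by (simp add: H_def)
  next
    fix z :: "complex \<times> complex"
    have "M B (\<lambda>k. z) = fst z ^ card B * snd z ^ (p - card B)" if "B \<in> Pow ?P" for B
      unfolding M_def using that prod_if_const[of ?P B] by simp
    then have "R (\<lambda>k. z) = (\<Sum>B\<in>Pow ?P. fst z ^ card B * snd z ^ (p - card B) / of_nat (p choose card B))"
      by (simp add: R_def)
    also have "\<dots> = (\<Sum>l=0..p. fst z ^ l * snd z ^ (p - l))"
      by (subst sum_Pow_card) (auto intro!: sum.cong)
    finally show "H (\<lambda>k. z) = 0"
      using eq by (simp add: H_def L_def g_def solves_on_def)
  qed simp
  \<comment> \<open>This puts \<alpha> on the arguments in A and \<beta> on the others, while every
    product \<open>M B z\<close> with B different from A acquires a zero factor.\<close>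
  define z where "z k = (if k \<in> A then (w k, 0) else (0, w k))" for k
  have "M B z = (if B = A then \<Prod>k\<in>?P. w k else 0)" if "B \<in> Pow ?P" for B
  proof (cases "B = A")
    case False
    then obtain k where k: "(k \<in> A) \<noteq> (k \<in> B)" by blast
    then have "k \<in> ?P" using that A by blast
    with k have "\<exists>k\<in>?P. (if k \<in> B then fst (z k) else snd (z k)) = 0"
      by (intro bexI[of _ k]) (auto simp: z_def)
    then show ?thesis unfolding M_def using False by (simp add: prod_zero)
  qed (auto simp: M_def z_def intro!: prod.cong)
  then have "R z = (\<Prod>k\<in>?P. w k) / of_nat (p choose card A)"
    using A by (simp add: R_def if_distrib[of "\<lambda>x. x / _"] sum.delta cong: if_cong)
  moreover have "g i (z k) = (if k \<in> A then \<alpha> i else \<beta> i) * w k" for i k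
    by (simp add: g_def z_def)
  ultimately show ?thesis using zero[of z] by (simp add: H_def L_def)
qed

section \<open>Finitely generated subfields\<close>

text \<open>Formal field expressions serve to count a generated field: there are countably many of
  them, and each element of the field is the value of one.\<close>

datatype field_term = TermOne | TermGen nat | TermNeg field_term | TermInv field_term
  | TermAdd field_term field_term | TermMul field_term field_term

instance field_term :: countable by countable_datatype

lemma complex_field_simps [simp]:
  "carrier complex_field = UNIV" "x \<otimes>\<^bsub>complex_field\<^esub> y = x * y" "\<one>\<^bsub>complex_field\<^esub> = 1"
  "x \<oplus>\<^bsub>complex_field\<^esub> y = x + y" "\<zero>\<^bsub>complex_field\<^esub> = 0"
  by (simp_all add: ring_of_type_algebra_def)

lemma complex_field_field: "field complex_field"
  by (rule field_from_type_algebra)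

lemma a_inv_complex_field [simp]: "a_inv complex_field (x :: complex) = - x"
proof -
  interpret field complex_field by (rule complex_field_field)
  have "x \<oplus>\<^bsub>complex_field\<^esub> (\<ominus>\<^bsub>complex_field\<^esub> x) = \<zero>\<^bsub>complex_field\<^esub>" by (rule r_neg) simp
  then show ?thesis by (simp add: add_eq_0_iff)
qed

lemma m_inv_complex_field:
  assumes "(x :: complex) \<noteq> 0" shows "m_inv complex_field x = inverse x"
proof -
  interpret field complex_field by (rule complex_field_field)
  have "x \<in> Units complex_field" using assms by (simp add: field_Units)
  then have "x \<otimes>\<^bsub>complex_field\<^esub> (inv\<^bsub>complex_field\<^esub> x) = \<one>\<^bsub>complex_field\<^esub>" by (rule Units_r_inv)
  then have "x * m_inv complex_field x = 1" by simp
  then show ?thesis by (simp add: inverse_unique)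
qed

primrec eval_term :: "(nat \<Rightarrow> complex) \<Rightarrow> field_term \<Rightarrow> complex" where
  "eval_term g TermOne = 1"
| "eval_term g (TermGen k) = g k"
| "eval_term g (TermNeg s) = - eval_term g s"
| "eval_term g (TermInv s) = inverse (eval_term g s)"
| "eval_term g (TermAdd s t) = eval_term g s + eval_term g t"
| "eval_term g (TermMul s t) = eval_term g s * eval_term g t"

lemma countable_generate_field:
  assumes "countable S" shows "countable (generate_field complex_field S)"
proof (rule countable_subset)
  show "generate_field complex_field S \<subseteq> range (eval_term (from_nat_into S))"
  proof
    fix x assume "x \<in> generate_field complex_field S"
    then show "x \<in> range (eval_term (from_nat_into S))"
    proof (induction rule: generate_field.induct)
      case one then show ?case by (intro range_eqI[of _ _ TermOne]) simp
    next
      case (incl h)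
      then have "h = eval_term (from_nat_into S) (TermGen (to_nat_on S h))" using assms by simp
      then show ?case by (rule range_eqI)
    next
      case (a_inv h)
      then obtain s where "h = eval_term (from_nat_into S) s" by blast
      then show ?case by (intro range_eqI[of _ _ "TermNeg s"]) simp
    next
      case (m_inv h)
      then obtain s where "h = eval_term (from_nat_into S) s" by blast
      with m_inv.hyps show ?case
        by (intro range_eqI[of _ _ "TermInv s"]) (simp add: m_inv_complex_field)
    next
      case (eng_add h1 h2)
      then obtain s t where "h1 = eval_term (from_nat_into S) s" "h2 = eval_term (from_nat_into S) t"
        by blast
      then show ?case by (intro range_eqI[of _ _ "TermAdd s t"]) simp
    next
      case (eng_mult h1 h2)
      then obtain s t where "h1 = eval_term (from_nat_into S) s" "h2 = eval_term (from_nat_into S) t"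
        by blast
      then show ?case by (intro range_eqI[of _ _ "TermMul s t"]) simp
    qed
  qed
qed simp

lemma generate_field_closed:
  fixes S :: "complex set"
  defines "K \<equiv> generate_field complex_field S"
  shows "1 \<in> K" "0 \<in> K" "\<And>x. x \<in> S \<Longrightarrow> x \<in> K" "\<And>x y. x \<in> K \<Longrightarrow> y \<in> K \<Longrightarrow> x + y \<in> K"
    "\<And>x y. x \<in> K \<Longrightarrow> y \<in> K \<Longrightarrow> x * y \<in> K" "\<And>x. x \<in> K \<Longrightarrow> - x \<in> K"
    "\<And>x. x \<in> K \<Longrightarrow> inverse x \<in> K"
proof -
  show 1: "1 \<in> K" using generate_field.one[of complex_field S] by (simp add: K_def)
  show "\<And>x. x \<in> S \<Longrightarrow> x \<in> K" unfolding K_def by (rule generate_field.incl)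
  show add: "x + y \<in> K" if "x \<in> K" "y \<in> K" for x y
    using generate_field.eng_add[of x complex_field S y] that by (simp add: K_def)
  show "x * y \<in> K" if "x \<in> K" "y \<in> K" for x y
    using generate_field.eng_mult[of x complex_field S y] that by (simp add: K_def)
  show neg: "- x \<in> K" if "x \<in> K" for x
    using generate_field.a_inv[of x complex_field S] that by (simp add: K_def)
  show 0: "0 \<in> K" using add[OF 1 neg[OF 1]] by simp
  show "inverse x \<in> K" if "x \<in> K" for x
    using generate_field.m_inv[of x complex_field S] that 0
    by (cases "x = 0") (simp_all add: K_def m_inv_complex_field)
qed

lemma generate_field_finitely_generated:
  assumes "finite S" shows "finitely_generated_subfield (generate_field complex_field S)"
proof -
  interpret field complex_field by (rule complex_field_field)
  show ?thesis
    unfolding finitely_generated_subfield_def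
    using generate_field_is_subfield[of S] assms by auto
qed

text \<open>
  The monoid of tuples is replaced by the countable free commutative monoid of multisets of codes of
  tuples, which makes the monoid algebra available as a type.
\<close>

lemma multiplicative_spectral_analysis:
  fixes M :: "(nat \<Rightarrow> complex) set" and K :: "complex set" and p :: nat and F :: "(nat \<Rightarrow> complex) \<Rightarrow> complex"
  defines "M \<equiv> tuples p K"
  assumes K: "countable K" "1 \<in> K" "\<And>x y. x \<in> K \<Longrightarrow> y \<in> K \<Longrightarrow> x * y \<in> K"
    and F: "w0 \<in> M" "F w0 \<noteq> 0"
  obtains \<phi> where "\<phi> (\<lambda>k\<in>{1..p}. 1) = 1"
    "\<And>v w. v \<in> M \<Longrightarrow> w \<in> M \<Longrightarrow> \<phi> (\<lambda>k\<in>{1..p}. v k * w k) = \<phi> v * \<phi> w"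
    "\<And>(I :: nat set) (J :: nat set) c d v w. finite I \<Longrightarrow> finite J \<Longrightarrow>
       (\<And>i. i \<in> I \<Longrightarrow> v i \<in> M) \<Longrightarrow> (\<And>j. j \<in> J \<Longrightarrow> w j \<in> M) \<Longrightarrow>
       (\<And>u. u \<in> M \<Longrightarrow> (\<Sum>i\<in>I. c i * F (\<lambda>k\<in>{1..p}. v i k * u k)) =
         (\<Sum>j\<in>J. d j * F (\<lambda>k\<in>{1..p}. w j k * u k))) \<Longrightarrow>
       (\<Sum>i\<in>I. c i * \<phi> (v i)) = (\<Sum>j\<in>J. d j * \<phi> (w j))"
proof -
  have M: "countable M" "M \<noteq> {}"
    using F(1) by (auto simp: M_def intro!: countable_PiE K(1))
  \<comment> \<open>The homomorphism from multisets of codes onto the monoid of tuples: the coded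
    tuples are multiplied together.\<close>
  define t where "t m = (\<lambda>k\<in>{1..p}. \<Prod>i\<in>#m. from_nat_into M i k)" for m :: "nat multiset"
  define code where "code w = {#to_nat_on M w#}" for w
  have t_code: "t (code w) = w" if "w \<in> M" for w
  proof -
    have "t (code w) = restrict w {1..p}"
      unfolding t_def code_def using that M(1) by (simp add: from_nat_into_to_nat_on)
    then show ?thesis using that by (simp add: M_def PiE_restrict)
  qed
  have t_add: "t (m + n) = (\<lambda>k\<in>{1..p}. t m k * t n k)" for m n
    unfolding t_def by (auto simp: fun_eq_iff)
  have mult: "(\<lambda>k\<in>{1..p}. v k * w k) \<in> M" if "v \<in> M" "w \<in> M" for v w
    using that K(3) by (auto simp: M_def PiE_iff)
  have t_in: "t m \<in> M" for m
  proof (induction m)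
    case empty then show ?case using K(2) by (auto simp: t_def M_def)
  next
    case (add i m)
    have "from_nat_into M i \<in> M" using M by (simp add: from_nat_into)
    moreover have "t (add_mset i m) = (\<lambda>k\<in>{1..p}. from_nat_into M i k * t m k)"
      by (auto simp: t_def fun_eq_iff)
    ultimately show ?case using mult[OF _ add] by (simp only:)
  qed
  have "countable (UNIV :: nat multiset set)"
    by (subst surj_mset[symmetric]) (intro countable_image countableI_type)
  moreover have "F (t (code w0)) \<noteq> 0" using F by (simp add: t_code)
  ultimately obtain \<xi> where \<xi>: "\<xi> 0 = 1" "\<And>m n. \<xi> (m + n) = \<xi> m * \<xi> n"
    and rel: "\<And>(A :: nat set) (B :: nat set) c d g h. finite A \<Longrightarrow> finite B \<Longrightarrow>
       (\<And>m. (\<Sum>i\<in>A. c i * F (t (g i + m))) = (\<Sum>i\<in>B. d i * F (t (h i + m)))) \<Longrightarrow>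
       (\<Sum>i\<in>A. c i * \<xi> (g i)) = (\<Sum>i\<in>B. d i * \<xi> (h i))"
    by (rule spectral_analysis[of "\<lambda>m. F (t m)"]) blast
  \<comment> \<open>Multisets with the same product give the same translates of \<open>F\<close>,
    which is a relation with one term on each side; hence \<xi> descends to tuples.\<close>
  have \<xi>_cong: "\<xi> m = \<xi> n" if "t m = t n" for m n
    using rel[of "{0}" "{0}" "\<lambda>_. 1" "\<lambda>_. m" "\<lambda>_. 1" "\<lambda>_. n"] that by (simp add: t_add)
  have one: "(\<lambda>k\<in>{1..p}. 1) \<in> M" using K(2) by (auto simp: M_def)
  show ?thesis
  proof (rule that[of "\<lambda>w. \<xi> (code w)"])
    show "\<xi> (code (\<lambda>k\<in>{1..p}. 1)) = 1"
      using \<xi>_cong[of "code (\<lambda>k\<in>{1..p}. 1)" 0] t_code[OF one] \<xi>(1) by (simp add: t_def)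
    show "\<xi> (code (\<lambda>k\<in>{1..p}. v k * w k)) = \<xi> (code v) * \<xi> (code w)" if "v \<in> M" "w \<in> M" for v w
      unfolding \<xi>(2)[symmetric] using that by (intro \<xi>_cong) (simp only: t_add t_code mult)
    fix I J :: "nat set" and c d v w
    assume "finite I" "finite J" and v: "\<And>i. i \<in> I \<Longrightarrow> v i \<in> M" and w: "\<And>j. j \<in> J \<Longrightarrow> w j \<in> M"
      and eq: "\<And>u. u \<in> M \<Longrightarrow> (\<Sum>i\<in>I. c i * F (\<lambda>k\<in>{1..p}. v i k * u k)) =
         (\<Sum>j\<in>J. d j * F (\<lambda>k\<in>{1..p}. w j k * u k))"
    have "(\<Sum>i\<in>I. c i * F (t (code (v i) + m))) = (\<Sum>j\<in>J. d j * F (t (code (w j) + m)))" for m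
      using eq[OF t_in[of m]] by (simp add: t_add t_code v w cong: sum.cong)
    then show "(\<Sum>i\<in>I. c i * \<xi> (code (v i))) = (\<Sum>j\<in>J. d j * \<xi> (code (w j)))"
      by (rule rel[OF \<open>finite I\<close> \<open>finite J\<close>])
  qed
qed

text \<open>A nonzero x in K has an inverse in K, so \<phi>(x) is nonzero because \<phi>(1) = 1. The
  graph of \<phi> over K is therefore a countable partial isomorphism.\<close>

lemma subfield_embedding_extends:
  fixes \<phi> :: "complex \<Rightarrow> complex"
  assumes K: "countable K" "1 \<in> K" "\<And>x y. x \<in> K \<Longrightarrow> y \<in> K \<Longrightarrow> x + y \<in> K"
    "\<And>x y. x \<in> K \<Longrightarrow> y \<in> K \<Longrightarrow> x * y \<in> K" "\<And>x. x \<in> K \<Longrightarrow> - x \<in> K" "\<And>x. x \<in> K \<Longrightarrow> inverse x \<in> K"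
    and \<phi>: "\<phi> 1 = 1" "\<And>x y. x \<in> K \<Longrightarrow> y \<in> K \<Longrightarrow> \<phi> (x + y) = \<phi> x + \<phi> y"
    "\<And>x y. x \<in> K \<Longrightarrow> y \<in> K \<Longrightarrow> \<phi> (x * y) = \<phi> x * \<phi> y"
  obtains \<psi> where "\<psi> \<in> ring_iso complex_field complex_field" "\<And>x. x \<in> K \<Longrightarrow> \<psi> x = \<phi> x"
proof -
  define r where "r = (\<lambda>x. (x, \<phi> x)) ` K"
  have diff: "x - y \<in> K \<and> \<phi> (x - y) = \<phi> x - \<phi> y" if "x \<in> K" "y \<in> K" for x y
  proof -
    have "x - y \<in> K" using K(3)[OF that(1) K(5)[OF that(2)]] by simp
    then show ?thesis using \<phi>(2)[of "x - y" y] that by simp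
  qed
  have \<phi>0: "\<phi> 0 = 0" using diff[OF K(2,2)] by simp
  have nz: "x = 0" if "x \<in> K" "\<phi> x = 0" for x
    using \<phi>(3)[OF that(1) K(6)[OF that(1)]] \<phi>(1) that(2) by (cases "x = 0") auto
  have "partial_iso r"
    unfolding partial_iso_def r_def using K(2,4) \<phi>(1,3) diff nz \<phi>0 by (auto simp: image_iff)
  moreover have "countable r" using K(1) by (simp add: r_def)
  ultimately obtain \<sigma> where \<sigma>: "bij \<sigma>" "\<sigma> 1 = 1" "\<And>x y. \<sigma> (x + y) = \<sigma> x + \<sigma> y"
    "\<And>x y. \<sigma> (x * y) = \<sigma> x * \<sigma> y" "\<And>x y. (x, y) \<in> r \<Longrightarrow> \<sigma> x = y"
    by (rule countable_partial_iso_extends) blast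
  show ?thesis
    by (rule that[of \<sigma>]) (use \<sigma> in \<open>auto simp: ring_iso_def ring_hom_def r_def\<close>)
qed

section \<open>The exponential solution\<close>

lemma prod_split_le:
  fixes f g :: "nat \<Rightarrow> 'a::comm_monoid_mult"
  assumes "l \<le> p"
  shows "(\<Prod>k=1..p. if k \<le> l then f k else g k) = (\<Prod>k=1..l. f k) * (\<Prod>k=l+1..p. g k)"
proof -
  have "{1..p} = {1..l} \<union> {l+1..p}" using assms by auto
  then have "(\<Prod>k=1..p. if k \<le> l then f k else g k) =
      (\<Prod>k=1..l. if k \<le> l then f k else g k) * (\<Prod>k=l+1..p. if k \<le> l then f k else g k)"
    by (simp only:) (rule prod.union_disjoint; auto)
  then show ?thesis by simp
qed

lemma prod_split_shift:
  fixes f g :: "nat \<Rightarrow> 'a::comm_monoid_mult"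
  assumes "l \<le> p"
  shows "(\<Prod>k=1..p. if k \<le> l then f k else g (k - l)) = (\<Prod>k=1..l. f k) * (\<Prod>k=1..p-l. g k)"
proof -
  have "(\<Prod>k=l+1..p. g (k - l)) = (\<Prod>k=1..p-l. g k)"
    by (rule prod.reindex_bij_witness[of _ "\<lambda>k. k + l" "\<lambda>k. k - l"]) auto
  then show ?thesis using prod_split_le[OF assms, of f "\<lambda>k. g (k - l)"] by simp
qed

lemma mult_if_if:
  "(if b then x else y) * (if b then u else v) = (if b then x * u else y * v)"
  by simp

text \<open>By the binomial theorem, the coefficient of x^l y^(p-l) on the left is c / ct times the
  sum that \<open>power_condition\<close> sets equal to ct.\<close>

lemma power_solution:
  assumes c: "c \<noteq> 0" and pc: "power_condition n a \<alpha> \<beta> p ct"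
  shows "generalized_monomial p (\<lambda>x. c / ct * x ^ p) \<and>
    (\<lambda>x. c / ct * x ^ p) \<noteq> (\<lambda>x. 0) \<and>
    solves_on UNIV n a \<alpha> \<beta> p c (\<lambda>x. c / ct * x ^ p)"
proof (intro conjI)
  have ct: "ct \<noteq> 0" and sums: "(\<Sum>i=1..n. a i * \<alpha> i ^ p) = ct" "(\<Sum>i=1..n. a i * \<beta> i ^ p) = ct"
    "\<And>l. l \<in> {1..p-1} \<Longrightarrow> (\<Sum>i=1..n. a i * of_nat (p choose l) * \<alpha> i ^ l * \<beta> i ^ (p - l)) = ct"
    using pc unfolding power_condition_def by auto
  define F where "F = (\<lambda>w\<in>tuples p UNIV. c / ct * (\<Prod>k=1..p. w k))"
  show "generalized_monomial p (\<lambda>x. c / ct * x ^ p)"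
    unfolding generalized_monomial_def
  proof (intro bexI[of _ F] conjI allI impI ballI)
    show "F \<in> multiadditive p UNIV"
      unfolding multiadditive_def
    proof (intro CollectI conjI ballI)
      show "F \<in> tuples p UNIV \<rightarrow>\<^sub>E UNIV" by (simp add: F_def)
      fix w j u v assume w: "w \<in> tuples p UNIV" and j: "j \<in> {1..p}"
      have "F (w(j := x)) = c / ct * (x * (\<Prod>k\<in>{1..p}-{j}. w k))" for x
      proof -
        have "w(j := x) \<in> tuples p UNIV" using w j by (auto simp: PiE_iff extensional_def)
        moreover have "(\<Prod>k\<in>{1..p}-{j}. (w(j := x)) k) = (\<Prod>k\<in>{1..p}-{j}. w k)"
          by (intro prod.cong) auto
        moreover have "(\<Prod>k\<in>{1..p}. (w(j := x)) k) = (w(j := x)) j * (\<Prod>k\<in>{1..p}-{j}. (w(j := x)) k)"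
          by (rule prod.remove[OF finite_atLeastAtMost j])
        ultimately show ?thesis unfolding F_def by (simp only: restrict_apply' fun_upd_same)
      qed
      then show "F (w(j := u + v)) = F (w(j := u)) + F (w(j := v))"
        by (simp add: algebra_simps add_divide_distrib)
    qed
    show "permute_args p \<sigma> F w = F w" if "\<sigma> permutes {1..p}" "w \<in> tuples p UNIV" for \<sigma> w
      using that prod.permute[OF that(1), of w] by (simp add: permute_args_def F_def o_def)
    show "c / ct * x ^ p = F (\<lambda>k\<in>{1..p}. x)" for x by (simp add: F_def)
  qed
  show "(\<lambda>x. c / ct * x ^ p) \<noteq> (\<lambda>x. 0)" using c ct by (auto simp: fun_eq_iff intro!: exI[of _ 1])
  \<comment> \<open>The extreme cases l = 0 and l = p are the two pure power sums, where the
    binomial coefficient is 1.\<close>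
  have coeff: "(\<Sum>i=1..n. a i * of_nat (p choose l) * \<alpha> i ^ l * \<beta> i ^ (p - l)) = ct" if "l \<le> p" for l
    using that sums by (cases "l = 0"; cases "l = p") auto
  show "solves_on UNIV n a \<alpha> \<beta> p c (\<lambda>x. c / ct * x ^ p)"
    unfolding solves_on_def
  proof (intro ballI)
    fix x y
    have "(\<Sum>i=1..n. a i * (c / ct * (\<alpha> i * x + \<beta> i * y) ^ p)) =
        (\<Sum>i=1..n. \<Sum>l\<le>p. c / ct * (x ^ l * y ^ (p - l)) * (a i * of_nat (p choose l) * \<alpha> i ^ l * \<beta> i ^ (p - l)))"
      unfolding binomial_ring sum_distrib_left
      by (intro sum.cong refl) (simp add: power_mult_distrib)
    also have "\<dots> = (\<Sum>l\<le>p. c / ct * (x ^ l * y ^ (p - l)) *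
        (\<Sum>i=1..n. a i * of_nat (p choose l) * \<alpha> i ^ l * \<beta> i ^ (p - l)))"
      by (subst sum.swap) (simp only: sum_distrib_left)
    also have "\<dots> = (\<Sum>l\<le>p. c * (x ^ l * y ^ (p - l)))"
    proof (rule sum.cong[OF refl])
      fix l assume "l \<in> {..p}"
      then show "c / ct * (x ^ l * y ^ (p - l)) *
          (\<Sum>i=1..n. a i * of_nat (p choose l) * \<alpha> i ^ l * \<beta> i ^ (p - l)) = c * (x ^ l * y ^ (p - l))"
        using coeff[of l] ct by simp
    qed
    finally show "(\<Sum>i=1..n. a i * (c / ct * (\<alpha> i * x + \<beta> i * y) ^ p)) =
        c * (\<Sum>l=0..p. x ^ l * y ^ (p - l))"
      by (simp add: sum_distrib_left atLeast0AtMost)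
  qed
qed

lemma spectral_solution:
  fixes n p :: nat and a \<alpha> \<beta> :: "nat \<Rightarrow> complex" and c :: complex
  notes One_nat_def [simp del]
  assumes f: "generalized_monomial p f" "f \<noteq> (\<lambda>x. 0)" "solves_on UNIV n a \<alpha> \<beta> p c f"
  shows "\<exists>K \<phi> \<psi>.
         finitely_generated_subfield K \<and> (\<forall>i\<in>{1..n}. \<alpha> i \<in> K \<and> \<beta> i \<in> K) \<and>
         \<phi> \<in> S_star n a \<alpha> \<beta> p K \<and> exponential_on (G_star p K) \<phi> \<and>
         (\<forall>j\<in>{1..p}. \<psi> j \<in> ring_iso complex_field complex_field) \<and>
         (\<forall>j\<in>{1..p}. \<forall>x\<in>K - {0}. \<psi> j x = \<phi> (\<lambda>k\<in>{1..p}. if k = j then x else 1)) \<and>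
         (\<forall>x\<in>tuples p (K - {0}). \<phi> x = (\<Prod>j=1..p. \<psi> j (x j))) \<and>
         (\<exists>ct.
            solves_on K n a \<alpha> \<beta> p ct (\<lambda>x. \<Prod>j=1..p. \<psi> j x) \<and>
            (\<Sum>i=1..n. a i * (\<Prod>j=1..p. \<psi> j (\<alpha> i))) = ct \<and>
            (\<Sum>i=1..n. a i * (\<Prod>j=1..p. \<psi> j (\<beta> i))) = ct \<and>
            (\<forall>l\<in>{1..p-1}. \<forall>\<sigma>. \<sigma> permutes {1..p} \<longrightarrow>
               (\<Sum>i=1..n. a i * of_nat (p choose l) *
                  (\<Prod>j=1..l. \<psi> (\<sigma> j) (\<alpha> i)) * (\<Prod>j=l+1..p. \<psi> (\<sigma> j) (\<beta> i))) = ct) \<and>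
            (ct = 0 \<longrightarrow>
               (\<forall>x y. (\<Sum>i=1..n. a i * (\<Prod>j=1..p. \<psi> j (\<alpha> i * x + \<beta> i * y))) = 0)) \<and>
            (ct \<noteq> 0 \<longrightarrow>
               (\<forall>j\<in>{1..p}. \<forall>x\<in>K. \<psi> j x = x) \<and> power_condition n a \<alpha> \<beta> p ct))"
proof -

  \<comment> \<open>The field K and the polarized identities of \<open>F\<close>\<close>
  let ?P = "{1..p}"
  obtain F where F: "F \<in> multiadditive p UNIV"
    and sym: "\<And>\<sigma> w. \<sigma> permutes ?P \<Longrightarrow> w \<in> tuples p UNIV \<Longrightarrow> permute_args p \<sigma> F w = F w"
    and fF: "f = (\<lambda>x. F (\<lambda>k\<in>?P. x))"
    using f(1) unfolding generalized_monomial_def by (auto simp: fun_eq_iff)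
  obtain x0 where x0: "F (\<lambda>k\<in>?P. x0) \<noteq> 0" using f(2) fF by auto
  define gens where "gens = \<alpha> ` {1..n} \<union> \<beta> ` {1..n} \<union> {x0}"
  define K where "K = generate_field complex_field gens"
  note K = generate_field_closed[where S = gens, folded K_def]
  have fin: "finite gens" by (simp add: gens_def)
  have K_fg: "finitely_generated_subfield K"
    unfolding K_def using fin by (rule generate_field_finitely_generated)
  have K_cnt: "countable K"
    unfolding K_def using fin by (intro countable_generate_field countable_finite)
  have \<alpha>\<beta>: "\<alpha> i \<in> K" "\<beta> i \<in> K" if "i \<in> {1..n}" for i
    using that by (auto intro!: K(3) simp: gens_def)
  define M where "M = tuples p K"
  define U where "U A i = (\<lambda>k\<in>?P. if k \<in> A then \<alpha> i else \<beta> i)" for A i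
  have U: "U A i \<in> M" if "i \<in> {1..n}" for A i
    using \<alpha>\<beta>[OF that] by (auto simp: U_def M_def)
  have M_mult: "(\<lambda>k\<in>?P. v k * w k) \<in> M" if "v \<in> M" "w \<in> M" for v w
    using that K(5) by (auto simp: M_def PiE_iff)
  have pol: "(\<Sum>i=1..n. a i * F (\<lambda>k\<in>?P. U A i k * w k)) = c / of_nat (p choose card A) * (\<Prod>k\<in>?P. w k)"
    if "A \<subseteq> ?P" for A w
  proof -
    have "(\<lambda>k\<in>?P. U A i k * w k) = (\<lambda>k\<in>?P. (if k \<in> A then \<alpha> i else \<beta> i) * w k)" for i
      by (auto simp: U_def fun_eq_iff)
    then show ?thesis using polarized_equation[OF F sym f(3)[unfolded fF] that, of w] by (simp only:)
  qed

  \<comment> \<open>The character \<phi> and the relations it inherits\<close>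
  obtain \<phi> where \<phi>1: "\<phi> (\<lambda>k\<in>?P. 1) = 1"
    and \<phi>_mult: "\<And>v w. v \<in> M \<Longrightarrow> w \<in> M \<Longrightarrow> \<phi> (\<lambda>k\<in>?P. v k * w k) = \<phi> v * \<phi> w"
    and rel: "\<And>(I :: nat set) (J :: nat set) c d v w. finite I \<Longrightarrow> finite J \<Longrightarrow>
       (\<And>i. i \<in> I \<Longrightarrow> v i \<in> M) \<Longrightarrow> (\<And>j. j \<in> J \<Longrightarrow> w j \<in> M) \<Longrightarrow>
       (\<And>u. u \<in> M \<Longrightarrow> (\<Sum>i\<in>I. c i * F (\<lambda>k\<in>?P. v i k * u k)) =
         (\<Sum>j\<in>J. d j * F (\<lambda>k\<in>?P. w j k * u k))) \<Longrightarrow>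
       (\<Sum>i\<in>I. c i * \<phi> (v i)) = (\<Sum>j\<in>J. d j * \<phi> (w j))"
  proof (rule multiplicative_spectral_analysis[of K "\<lambda>k\<in>?P. x0" p F])
    show "(\<lambda>k\<in>?P. x0) \<in> tuples p K" using K(3)[of x0] by (simp add: gens_def)
  qed (use K_cnt K x0 in \<open>auto simp: M_def\<close>)
  define S where "S A = (\<Sum>i=1..n. a i * \<phi> (U A i))" for A
  define ct where "ct = S ?P"
  \<comment> \<open>Multiplied by the binomial coefficient, the right-hand side of
    \<open>pol\<close> is the same for A as for \<open>?P\<close>; equating the two left-hand sides
    gives a relation free of c.\<close>
  have S_eq: "of_nat (p choose card A) * S A = ct" if A: "A \<subseteq> ?P" for A
  proof -
    have ch: "p choose card A \<noteq> 0" using card_mono[OF _ A] by simp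
    have "(\<Sum>i=1..n. (of_nat (p choose card A) * a i) * \<phi> (U A i)) = (\<Sum>i=1..n. a i * \<phi> (U ?P i))"
    proof (rule rel)
      fix u assume "u \<in> M"
      have "(\<Sum>i=1..n. (of_nat (p choose card A) * a i) * F (\<lambda>k\<in>?P. U A i k * u k)) =
          of_nat (p choose card A) * (\<Sum>i=1..n. a i * F (\<lambda>k\<in>?P. U A i k * u k))"
        by (simp add: sum_distrib_left mult.assoc)
      also have "\<dots> = (\<Sum>i=1..n. a i * F (\<lambda>k\<in>?P. U ?P i k * u k))"
        unfolding pol[OF A] pol[OF order_refl] using ch by simp
      finally show "(\<Sum>i=1..n. (of_nat (p choose card A) * a i) * F (\<lambda>k\<in>?P. U A i k * u k)) =
          (\<Sum>i=1..n. a i * F (\<lambda>k\<in>?P. U ?P i k * u k))" .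
    qed (use U in auto)
    then show ?thesis by (simp add: S_def ct_def sum_distrib_left mult.assoc)
  qed
  \<comment> \<open>The relation says that multiplying the arguments in \<open>pol\<close> by x only
    contributes the product of x; multiplicativity of \<phi> extracts \<phi>(x) on the left.\<close>
  have ct_\<phi>: "ct * \<phi> x = ct * (\<Prod>k\<in>?P. x k)" if x: "x \<in> M" for x
  proof -
    have "(\<Sum>i=1..n. a i * \<phi> (\<lambda>k\<in>?P. U ?P i k * x k)) =
        (\<Sum>i=1..n. ((\<Prod>k\<in>?P. x k) * a i) * \<phi> (U ?P i))"
    proof (rule rel)
      fix u assume "u \<in> M"
      have "(\<lambda>k\<in>?P. (\<lambda>k\<in>?P. U ?P i k * x k) k * u k) = (\<lambda>k\<in>?P. U ?P i k * (x k * u k))" for i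
        by (auto simp: fun_eq_iff)
      then have "(\<Sum>i=1..n. a i * F (\<lambda>k\<in>?P. (\<lambda>k\<in>?P. U ?P i k * x k) k * u k)) =
          (\<Prod>k\<in>?P. x k) * (\<Sum>i=1..n. a i * F (\<lambda>k\<in>?P. U ?P i k * u k))"
        using pol[OF order_refl, of "\<lambda>k. x k * u k"] pol[OF order_refl, of u] by (simp add: prod.distrib)
      then show "(\<Sum>i=1..n. a i * F (\<lambda>k\<in>?P. (\<lambda>k\<in>?P. U ?P i k * x k) k * u k)) =
          (\<Sum>i=1..n. ((\<Prod>k\<in>?P. x k) * a i) * F (\<lambda>k\<in>?P. U ?P i k * u k))"
        by (simp add: sum_distrib_left mult.assoc)
    qed (use U M_mult x in auto)
    moreover have "(\<Sum>i=1..n. a i * \<phi> (\<lambda>k\<in>?P. U ?P i k * x k)) = ct * \<phi> x"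
      using \<phi>_mult[OF U x] by (simp add: ct_def S_def sum_distrib_right mult.assoc)
    ultimately show ?thesis
      by (simp add: ct_def S_def sum_distrib_left mult.assoc mult.left_commute mult.commute)
  qed
  have \<phi>_add: "\<phi> (w(j := u + v)) = \<phi> (w(j := u)) + \<phi> (w(j := v))"
    if w: "w \<in> M" and j: "j \<in> ?P" and uv: "u \<in> K" "v \<in> K" for w j u v
  proof -
    have M_upd: "w(j := x) \<in> M" if "x \<in> K" for x
      using w j that by (auto simp: M_def PiE_iff extensional_def)
    \<comment> \<open>Additivity of \<open>F\<close> in argument j, read as a relation with one
      translate on the left and two on the right; it persists after multiplying all arguments by y
      because argument j distributes.\<close>
    have "(\<Sum>i\<in>{0::nat}. 1 * \<phi> (w(j := u + v))) =
        (\<Sum>i\<in>{0::nat, 1}. 1 * \<phi> (if i = 0 then w(j := u) else w(j := v)))"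
    proof (rule rel)
      fix y assume y: "y \<in> M"
      have upd: "(\<lambda>k\<in>?P. (w(j := x)) k * y k) = (\<lambda>k\<in>?P. w k * y k)(j := x * y j)" for x
        using j by (auto simp: fun_eq_iff)
      have "F (\<lambda>k\<in>?P. (w(j := u + v)) k * y k) =
          F (\<lambda>k\<in>?P. (w(j := u)) k * y k) + F (\<lambda>k\<in>?P. (w(j := v)) k * y k)"
        unfolding upd distrib_right by (rule multiadditiveD[OF F _ j]) auto
      then show "(\<Sum>i\<in>{0::nat}. 1 * F (\<lambda>k\<in>?P. (w(j := u + v)) k * y k)) =
          (\<Sum>i\<in>{0::nat, 1}. 1 * F (\<lambda>k\<in>?P. (if i = 0 then w(j := u) else w(j := v)) k * y k))"
        by simp
    qed (use M_upd uv K(4) in auto)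
    then show ?thesis by simp
  qed

  \<comment> \<open>Coordinate embeddings and the product decomposition of \<phi>\<close>
  define e where "e j x = (\<lambda>k\<in>?P. if k = j then x else (1 :: complex))" for j x
  have e_upd: "e j x = (\<lambda>k\<in>?P. 1)(j := x)" if "j \<in> ?P" for j x
    using that by (auto simp: e_def fun_eq_iff)
  have e_in: "e j x \<in> M" if "x \<in> K" for j x
    using that K(1) by (auto simp: e_def M_def)
  have one_in: "(\<lambda>k\<in>?P. 1) \<in> M" using K(1) by (auto simp: M_def)
  have "\<exists>\<psi>. j \<in> ?P \<longrightarrow> \<psi> \<in> ring_iso complex_field complex_field \<and> (\<forall>x\<in>K. \<psi> x = \<phi> (e j x))" for j
  proof (cases "j \<in> ?P")
    case True
    have "\<phi> (e j (x + y)) = \<phi> (e j x) + \<phi> (e j y)" if "x \<in> K" "y \<in> K" for x y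
      unfolding e_upd[OF True] by (rule \<phi>_add[OF one_in True that])
    moreover have "\<phi> (e j (x * y)) = \<phi> (e j x) * \<phi> (e j y)" if "x \<in> K" "y \<in> K" for x y
    proof -
      have "e j (x * y) = (\<lambda>k\<in>?P. e j x k * e j y k)" by (auto simp: e_def fun_eq_iff)
      then show ?thesis using \<phi>_mult e_in that by simp
    qed
    moreover have "\<phi> (e j 1) = 1" using \<phi>1 by (simp add: e_def cong: restrict_cong)
    ultimately obtain \<psi> where "\<psi> \<in> ring_iso complex_field complex_field" "\<And>x. x \<in> K \<Longrightarrow> \<psi> x = \<phi> (e j x)"
      using subfield_embedding_extends[OF K_cnt K(1,4,5,6,7), of "\<lambda>x. \<phi> (e j x)"] by blast
    then show ?thesis by blast
  qed blast
  then obtain \<psi> where \<psi>: "\<And>j. j \<in> ?P \<Longrightarrow> \<psi> j \<in> ring_iso complex_field complex_field"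
    and \<psi>_K: "\<And>j x. j \<in> ?P \<Longrightarrow> x \<in> K \<Longrightarrow> \<psi> j x = \<phi> (e j x)"
    by metis
  have \<psi>_hom: "\<psi> j (x + y) = \<psi> j x + \<psi> j y" "\<psi> j (x * y) = \<psi> j x * \<psi> j y" if "j \<in> ?P" for j x y
    using \<psi>[OF that] by (simp_all add: ring_iso_def ring_hom_def)
  have \<phi>_prod: "\<phi> x = (\<Prod>j\<in>?P. \<psi> j (x j))" if x: "x \<in> M" for x
  proof -
    have xK: "x k \<in> K" if "k \<in> ?P" for k using x that by (auto simp: M_def)
    \<comment> \<open>The tuple is assembled one coordinate at a time, each new coordinate
      contributing the factor \<open>e j (x j)\<close>.\<close>
    have "\<phi> (\<lambda>k\<in>?P. if k \<in> A then x k else 1) = (\<Prod>j\<in>A. \<psi> j (x j))" if "finite A" "A \<subseteq> ?P" for A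
      using that
    proof (induction A rule: finite_induct)
      case empty
      have "(\<lambda>k\<in>?P. if k \<in> {} then x k else 1) = (\<lambda>k\<in>?P. 1)" by auto
      then show ?case using \<phi>1 by (simp only: prod.empty)
    next
      case (insert j A)
      have "(\<lambda>k\<in>?P. if k \<in> insert j A then x k else 1) =
          (\<lambda>k\<in>?P. e j (x j) k * (\<lambda>k\<in>?P. if k \<in> A then x k else 1) k)"
        using insert.hyps by (auto simp: e_def fun_eq_iff)
      moreover have "(\<lambda>k\<in>?P. if k \<in> A then x k else 1) \<in> M"
        using xK K(1) by (auto simp: M_def)
      moreover have "x j \<in> K" "\<psi> j (x j) = \<phi> (e j (x j))" using insert.prems \<psi>_K xK by auto
      moreover have "\<phi> (\<lambda>k\<in>?P. if k \<in> A then x k else 1) = (\<Prod>j\<in>A. \<psi> j (x j))"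
        using insert by blast
      ultimately show ?case
        by (simp only: \<phi>_mult e_in prod.insert[OF insert.hyps])
    qed
    from this[OF finite_atLeastAtMost order_refl]
    have "\<phi> (\<lambda>k\<in>?P. if k \<in> ?P then x k else 1) = (\<Prod>j\<in>?P. \<psi> j (x j))" .
    moreover have "(\<lambda>k\<in>?P. if k \<in> ?P then x k else 1) = restrict x ?P"
      by (rule restrict_ext) (rule if_P)
    moreover have "restrict x ?P = x" using x unfolding M_def by (rule PiE_restrict)
    ultimately show ?thesis by (simp only:)
  qed

  \<comment> \<open>Mixed sums and the two cases for ct\<close>
  have S_prod: "S A = (\<Sum>i=1..n. a i * (\<Prod>j\<in>?P. if j \<in> A then \<psi> j (\<alpha> i) else \<psi> j (\<beta> i)))" for A
  proof -
    have "(\<Prod>j\<in>?P. \<psi> j (U A i j)) = (\<Prod>j\<in>?P. if j \<in> A then \<psi> j (\<alpha> i) else \<psi> j (\<beta> i))" for i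
      by (intro prod.cong refl) (simp add: U_def)
    then show ?thesis unfolding S_def by (intro sum.cong refl) (simp add: \<phi>_prod[OF U])
  qed
  have S_div: "S A = ct / of_nat (p choose card A)" if A: "A \<subseteq> ?P" for A
  proof -
    have "p choose card A \<noteq> 0" using card_mono[OF _ A] by simp
    then show ?thesis using S_eq[OF A] by (simp add: eq_divide_eq mult.commute)
  qed
  \<comment> \<open>The \<psi> j are additive and multiplicative on all of \<complex>, so x and y
    range over \<complex> here. If ct = 0, all coefficients \<open>S B\<close> vanish and the
    homogeneous equation follows on \<complex>.\<close>
  have expand: "(\<Sum>i=1..n. a i * (\<Prod>j\<in>?P. \<psi> j (\<alpha> i * x + \<beta> i * y))) =
      (\<Sum>B\<in>Pow ?P. S B * (\<Prod>j\<in>?P. if j \<in> B then \<psi> j x else \<psi> j y))" for x y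
  proof -
    have "(\<Prod>j\<in>?P. \<psi> j (\<alpha> i * x + \<beta> i * y)) = (\<Sum>B\<in>Pow ?P.
        (\<Prod>j\<in>?P. if j \<in> B then \<psi> j (\<alpha> i) else \<psi> j (\<beta> i)) * (\<Prod>j\<in>?P. if j \<in> B then \<psi> j x else \<psi> j y))" for i
    proof -
      have "(\<Prod>j\<in>?P. \<psi> j (\<alpha> i * x + \<beta> i * y)) = (\<Prod>j\<in>?P. \<psi> j (\<alpha> i) * \<psi> j x + \<psi> j (\<beta> i) * \<psi> j y)"
        by (intro prod.cong refl) (simp add: \<psi>_hom)
      also have "\<dots> = (\<Sum>B\<in>Pow ?P. \<Prod>j\<in>?P. if j \<in> B then \<psi> j (\<alpha> i) * \<psi> j x else \<psi> j (\<beta> i) * \<psi> j y)"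
        by (rule prod_add_Pow) simp
      finally show ?thesis
        unfolding prod.distrib[symmetric] by (simp only: mult_if_if)
    qed
    then show ?thesis
      by (simp only: S_prod sum_distrib_left sum_distrib_right mult.assoc) (rule sum.swap)
  qed
  have \<psi>_id: "\<psi> j x = x" if "ct \<noteq> 0" "j \<in> ?P" "x \<in> K" for j x
  proof -
    have "\<phi> (e j x) = (\<Prod>k\<in>?P. e j x k)" using ct_\<phi>[OF e_in[OF that(3)], of j] that(1) by simp
    also have "\<dots> = x" using that(2) by (simp add: e_def prod.delta)
    finally show ?thesis using \<psi>_K that by simp
  qed
  have sum_\<sigma>: "(\<Sum>i=1..n. a i * of_nat (p choose l) *
      (\<Prod>j=1..l. \<psi> (\<sigma> j) (\<alpha> i)) * (\<Prod>j=l+1..p. \<psi> (\<sigma> j) (\<beta> i))) = ct"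
    if l: "l \<le> p" and \<sigma>: "\<sigma> permutes ?P" for l \<sigma>
  proof -
    have inj: "inj \<sigma>" using \<sigma> by (rule permutes_inj)
    \<comment> \<open>After permuting, \<alpha> sits exactly on the coordinates \<sigma>(1), ...,
      \<sigma>(l), and \<open>S\<close> depends only on this set.\<close>
    define A where "A = \<sigma> ` {1..l}"
    have A: "A \<subseteq> ?P" using permutes_in_image[OF \<sigma>] l by (auto simp: A_def)
    have cA: "card A = l" using inj by (simp add: A_def card_image inj_on_subset)
    have "(\<Prod>j\<in>?P. if j \<in> A then \<psi> j (\<alpha> i) else \<psi> j (\<beta> i)) =
        (\<Prod>j=1..l. \<psi> (\<sigma> j) (\<alpha> i)) * (\<Prod>j=l+1..p. \<psi> (\<sigma> j) (\<beta> i))" for i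
    proof -
      have "(\<Prod>j\<in>?P. if j \<in> A then \<psi> j (\<alpha> i) else \<psi> j (\<beta> i)) =
          (\<Prod>j\<in>?P. if \<sigma> j \<in> A then \<psi> (\<sigma> j) (\<alpha> i) else \<psi> (\<sigma> j) (\<beta> i))"
        by (subst prod.permute[OF \<sigma>]) (simp add: o_def)
      also have "\<dots> = (\<Prod>j\<in>?P. if j \<le> l then \<psi> (\<sigma> j) (\<alpha> i) else \<psi> (\<sigma> j) (\<beta> i))"
        by (intro prod.cong refl) (simp add: A_def inj_image_mem_iff[OF inj])
      finally show ?thesis using prod_split_le[OF l] by simp
    qed
    then show ?thesis
      using S_eq[OF A] by (simp add: cA S_prod sum_distrib_left mult_ac)
  qed

  \<comment> \<open>Membership of \<phi> in the space S\<close>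
  have key: "of_nat (p choose card A) * (\<Sum>i=1..n. a i * \<phi> (\<lambda>k\<in>?P. U A i k * x k)) = ct * (\<Prod>k\<in>?P. x k)"
    if A: "A \<subseteq> ?P" and x: "x \<in> M" for A x
  proof -
    have "(\<Sum>i=1..n. a i * \<phi> (\<lambda>k\<in>?P. U A i k * x k)) = S A * \<phi> x"
      using \<phi>_mult[OF U x] by (simp add: S_def sum_distrib_right mult.assoc)
    then show ?thesis using S_eq[OF A] ct_\<phi>[OF x] by (simp flip: mult.assoc)
  qed
  \<comment> \<open>Nothing is known of \<phi> outside M, while elements of
    \<open>multiadditive\<close> must be extensional.\<close>
  define \<Phi> where "\<Phi> = restrict \<phi> M"
  have \<Phi>_perm: "permute_args p \<sigma> \<Phi> w = \<phi> (\<lambda>k\<in>?P. w (\<sigma> k))"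
    if "\<sigma> permutes ?P" "\<And>k. k \<in> ?P \<Longrightarrow> w k \<in> K" for \<sigma> w
  proof -
    have "(\<lambda>k\<in>?P. w (\<sigma> k)) \<in> M"
      using that permutes_in_image[OF that(1)] by (auto simp: M_def)
    then show ?thesis by (simp add: permute_args_def \<Phi>_def)
  qed
  have "\<Phi> \<in> S_space n a \<alpha> \<beta> p K"
    unfolding S_space_def
  proof (intro CollectI conjI exI[of _ ct] allI impI ballI)
    show "\<Phi> \<in> multiadditive p K"
      unfolding multiadditive_def
    proof (intro CollectI conjI ballI)
      show "\<Phi> \<in> tuples p K \<rightarrow>\<^sub>E UNIV" by (simp add: \<Phi>_def M_def)
      fix w j u v assume w: "w \<in> tuples p K" and j: "j \<in> ?P" and uv: "u \<in> K" "v \<in> K"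
      have "w(j := x) \<in> M" if "x \<in> K" for x
        using w j that by (auto simp: M_def PiE_iff extensional_def)
      then show "\<Phi> (w(j := u + v)) = \<Phi> (w(j := u)) + \<Phi> (w(j := v))"
        using \<phi>_add[of w j u v] w j uv K(4) by (simp add: \<Phi>_def M_def)
    qed
  next
    fix \<sigma> assume \<sigma>: "\<sigma> permutes ?P"
    note img = permutes_in_image[OF \<sigma>]
    have xs: "(\<lambda>k\<in>?P. x (\<sigma> k)) \<in> M" if "x \<in> tuples p K" for x
      using that img by (auto simp: M_def PiE_iff)
    have prod_\<sigma>: "(\<Prod>k\<in>?P. x (\<sigma> k)) = (\<Prod>k\<in>?P. x k)" for x :: "nat \<Rightarrow> complex"
      by (subst (2) prod.permute[OF \<sigma>]) (simp add: o_def)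
    show "(\<Sum>i=1..n. a i * permute_args p \<sigma> \<Phi> (\<lambda>k\<in>?P. \<alpha> i * x k)) = ct * (\<Prod>k=1..p. x k)"
      if x: "x \<in> tuples p K" for x
    proof -
      have "permute_args p \<sigma> \<Phi> (\<lambda>k\<in>?P. \<alpha> i * x k) = \<phi> (\<lambda>k\<in>?P. U ?P i k * (\<lambda>k\<in>?P. x (\<sigma> k)) k)"
        if i: "i \<in> {1..n}" for i
      proof (subst \<Phi>_perm[OF \<sigma>])
        show "(\<lambda>k\<in>?P. \<alpha> i * x k) k \<in> K" if "k \<in> ?P" for k
          using \<alpha>\<beta>[OF i] x K(5) that by (auto simp: PiE_iff)
        show "\<phi> (\<lambda>k\<in>?P. (\<lambda>k\<in>?P. \<alpha> i * x k) (\<sigma> k)) = \<phi> (\<lambda>k\<in>?P. U ?P i k * (\<lambda>k\<in>?P. x (\<sigma> k)) k)"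
          using img by (intro arg_cong[of _ _ \<phi>]) (auto simp: U_def fun_eq_iff)
      qed
      then show ?thesis using key[OF order_refl xs[OF x]] prod_\<sigma>[of x] by simp
    qed
    show "(\<Sum>i=1..n. a i * permute_args p \<sigma> \<Phi> (\<lambda>k\<in>?P. \<beta> i * x k)) = ct * (\<Prod>k=1..p. x k)"
      if x: "x \<in> tuples p K" for x
    proof -
      have "permute_args p \<sigma> \<Phi> (\<lambda>k\<in>?P. \<beta> i * x k) = \<phi> (\<lambda>k\<in>?P. U {} i k * (\<lambda>k\<in>?P. x (\<sigma> k)) k)"
        if i: "i \<in> {1..n}" for i
      proof (subst \<Phi>_perm[OF \<sigma>])
        show "(\<lambda>k\<in>?P. \<beta> i * x k) k \<in> K" if "k \<in> ?P" for k
          using \<alpha>\<beta>[OF i] x K(5) that by (auto simp: PiE_iff)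
        show "\<phi> (\<lambda>k\<in>?P. (\<lambda>k\<in>?P. \<beta> i * x k) (\<sigma> k)) = \<phi> (\<lambda>k\<in>?P. U {} i k * (\<lambda>k\<in>?P. x (\<sigma> k)) k)"
          using img by (intro arg_cong[of _ _ \<phi>]) (auto simp: U_def fun_eq_iff)
      qed
      then show ?thesis using key[OF empty_subsetI xs[OF x]] prod_\<sigma>[of x] by simp
    qed
    fix l x y assume l: "l \<in> {1..p-1}" and x: "x \<in> tuples p K" and y: "y \<in> tuples p K"
    define z where "z k = (if k \<le> l then x k else y (k - l))" for k
    \<comment> \<open>Slot k of the permuted function receives entry \<sigma> k, which carries
      \<alpha> exactly if \<sigma> k \<le> l. Hence A is the preimage of {1..l} here, whereas
      \<open>sum_\<sigma>\<close> works with its image.\<close>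
    define A where "A = {k \<in> ?P. \<sigma> k \<le> l}"
    have A: "A \<subseteq> ?P" by (auto simp: A_def)
    have zK: "z k \<in> K" if k: "k \<in> ?P" for k
    proof (cases "k \<le> l")
      case True then show ?thesis using x k by (auto simp: z_def)
    next
      case False
      then have "k - l \<in> ?P" using k by auto
      then show ?thesis using y False by (auto simp: z_def)
    qed
    then have zs: "(\<lambda>k\<in>?P. z (\<sigma> k)) \<in> M" using img by (auto simp: M_def)
    have "\<sigma> ` A = {1..l}"
    proof
      show "{1..l} \<subseteq> \<sigma> ` A"
      proof
        fix m assume m: "m \<in> {1..l}"
        then have "m \<in> \<sigma> ` ?P" using permutes_image[OF \<sigma>] l by auto
        then show "m \<in> \<sigma> ` A" using m by (auto simp: A_def)
      qed
      show "\<sigma> ` A \<subseteq> {1..l}"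
      proof
        fix m assume "m \<in> \<sigma> ` A"
        then obtain k where "k \<in> ?P" "m = \<sigma> k" "\<sigma> k \<le> l" by (auto simp: A_def)
        then show "m \<in> {1..l}" using img[of k] by simp
      qed
    qed
    then have cA: "card A = l"
      using card_image[of \<sigma> A] permutes_inj[OF \<sigma>] by (simp add: inj_on_subset)
    have "permute_args p \<sigma> \<Phi> (\<lambda>k\<in>?P. if k \<le> l then \<alpha> i * x k else \<beta> i * y (k - l)) =
        \<phi> (\<lambda>k\<in>?P. U A i k * (\<lambda>k\<in>?P. z (\<sigma> k)) k)" if i: "i \<in> {1..n}" for i
    proof (subst \<Phi>_perm[OF \<sigma>])
      show "(\<lambda>k\<in>?P. if k \<le> l then \<alpha> i * x k else \<beta> i * y (k - l)) k \<in> K" if "k \<in> ?P" for k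
        using \<alpha>\<beta>[OF i] zK[OF that] K(5) that by (auto simp: z_def split: if_splits)
      show "\<phi> (\<lambda>k\<in>?P. (\<lambda>k\<in>?P. if k \<le> l then \<alpha> i * x k else \<beta> i * y (k - l)) (\<sigma> k)) =
          \<phi> (\<lambda>k\<in>?P. U A i k * (\<lambda>k\<in>?P. z (\<sigma> k)) k)"
        using img by (intro arg_cong[of _ _ \<phi>]) (auto simp: U_def A_def z_def fun_eq_iff)
    qed
    then have "(\<Sum>i=1..n. a i * of_nat (p choose l) *
        permute_args p \<sigma> \<Phi> (\<lambda>k\<in>?P. if k \<le> l then \<alpha> i * x k else \<beta> i * y (k - l))) =
        of_nat (p choose l) * (\<Sum>i=1..n. a i * \<phi> (\<lambda>k\<in>?P. U A i k * (\<lambda>k\<in>?P. z (\<sigma> k)) k))"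
      by (simp add: sum_distrib_left mult.assoc mult.left_commute)
    also have "\<dots> = ct * (\<Prod>k\<in>?P. z k)"
      using key[OF A zs] prod_\<sigma>[of z] by (simp add: cA)
    also have "(\<Prod>k\<in>?P. z k) = (\<Prod>k=1..l. x k) * (\<Prod>k=1..p-l. y k)"
      unfolding z_def using l by (intro prod_split_shift) auto
    finally show "(\<Sum>i=1..n. a i * of_nat (p choose l) *
        permute_args p \<sigma> \<Phi> (\<lambda>k\<in>?P. if k \<le> l then \<alpha> i * x k else \<beta> i * y (k - l))) =
        ct * (\<Prod>k=1..l. x k) * (\<Prod>k=1..p-l. y k)"
      by (simp only: mult.assoc)
  qed

  \<comment> \<open>Restriction to nonzero tuples and the exponential\<close>
  define \<phi>' where "\<phi>' = restrict \<phi> (carrier (G_star p K))"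
  have car: "carrier (G_star p K) = tuples p (K - {0})" by (rule carrier_G_star)
  have sub: "tuples p (K - {0}) \<subseteq> M" by (auto simp: M_def PiE_iff)
  have \<phi>': "\<phi>' x = \<phi> x" if "x \<in> tuples p (K - {0})" for x
    using that by (simp add: \<phi>'_def car)
  have "\<phi>' = restrict \<Phi> (carrier (G_star p K))"
    using sub by (auto simp: \<phi>'_def \<Phi>_def car fun_eq_iff)
  then have S_star: "\<phi>' \<in> S_star n a \<alpha> \<beta> p K"
    using \<open>\<Phi> \<in> S_space n a \<alpha> \<beta> p K\<close> by (auto simp: S_star_def)
  have exp: "exponential_on (G_star p K) \<phi>'"
    unfolding exponential_on_def car mult_G_star
  proof (intro conjI bexI ballI)
    show "\<phi>' (\<lambda>k\<in>?P. 1) \<noteq> 0" "(\<lambda>k\<in>?P. 1) \<in> tuples p (K - {0})"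
      using \<phi>1 K(1) by (auto simp: \<phi>')
    fix x y assume xy: "x \<in> tuples p (K - {0})" "y \<in> tuples p (K - {0})"
    then have "(\<lambda>k\<in>?P. x k * y k) \<in> tuples p (K - {0})" using K(5) by (auto simp: PiE_iff)
    then show "\<phi>' (\<lambda>k\<in>?P. x k * y k) = \<phi>' x * \<phi>' y"
      using \<phi>_mult[of x y] xy sub by (auto simp: \<phi>')
  qed

  \<comment> \<open>Sums for \<alpha> and \<beta>, the power condition and the equation on K\<close>
  have sum_\<alpha>: "(\<Sum>i=1..n. a i * (\<Prod>j=1..p. \<psi> j (\<alpha> i))) = ct" by (simp add: ct_def S_prod)
  have sum_\<beta>: "(\<Sum>i=1..n. a i * (\<Prod>j=1..p. \<psi> j (\<beta> i))) = ct"
    using S_eq[of "{}"] by (simp add: S_prod)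
  have hom: "(\<Sum>i=1..n. a i * (\<Prod>j=1..p. \<psi> j (\<alpha> i * x + \<beta> i * y))) = 0" if "ct = 0" for x y
    unfolding expand using that by (intro sum.neutral) (simp add: S_div)
  have pc: "power_condition n a \<alpha> \<beta> p ct" if ct: "ct \<noteq> 0"
    unfolding power_condition_def
  proof (intro conjI ballI)
    have pow: "(\<Prod>j\<in>J. \<psi> j (\<alpha> i)) = \<alpha> i ^ card J" "(\<Prod>j\<in>J. \<psi> j (\<beta> i)) = \<beta> i ^ card J"
      if "i \<in> {1..n}" "J \<subseteq> ?P" for i J
      using that \<psi>_id[OF ct] \<alpha>\<beta> by (simp_all add: subset_iff)
    show "(\<Sum>i=1..n. a i * \<alpha> i ^ p) = ct"
      unfolding sum_\<alpha>[symmetric] using pow(1)[OF _ order_refl] by (intro sum.cong refl) simp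
    show "(\<Sum>i=1..n. a i * \<beta> i ^ p) = ct"
      unfolding sum_\<beta>[symmetric] using pow(2)[OF _ order_refl] by (intro sum.cong refl) simp
    fix l assume l: "l \<in> {1..p-1}"
    show "(\<Sum>i=1..n. a i * of_nat (p choose l) * \<alpha> i ^ l * \<beta> i ^ (p - l)) = ct"
    proof -
      have "ct = (\<Sum>i=1..n. a i * of_nat (p choose l) *
          (\<Prod>j=1..l. \<psi> (id j) (\<alpha> i)) * (\<Prod>j=l+1..p. \<psi> (id j) (\<beta> i)))"
        using l by (intro sum_\<sigma>[symmetric] permutes_id) auto
      also have "\<dots> = (\<Sum>i=1..n. a i * of_nat (p choose l) * \<alpha> i ^ l * \<beta> i ^ (p - l))"
      proof (rule sum.cong[OF refl])
        fix i assume i: "i \<in> {1..n}"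
        have "(\<Prod>j=1..l. \<psi> (id j) (\<alpha> i)) = \<alpha> i ^ l" "(\<Prod>j=l+1..p. \<psi> (id j) (\<beta> i)) = \<beta> i ^ (p - l)"
          using pow(1)[OF i, of "{1..l}"] pow(2)[OF i, of "{l+1..p}"] l by auto
        then show "a i * of_nat (p choose l) * (\<Prod>j=1..l. \<psi> (id j) (\<alpha> i)) *
            (\<Prod>j=l+1..p. \<psi> (id j) (\<beta> i)) = a i * of_nat (p choose l) * \<alpha> i ^ l * \<beta> i ^ (p - l)"
          by (simp only:)
      qed
      finally show ?thesis by (rule HOL.sym)
    qed
  qed (rule ct)
  have solves: "solves_on K n a \<alpha> \<beta> p ct (\<lambda>x. \<Prod>j=1..p. \<psi> j x)"
    unfolding solves_on_def
  proof (intro ballI)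
    fix x y assume xy: "x \<in> K" "y \<in> K"
    show "(\<Sum>i=1..n. a i * (\<Prod>j=1..p. \<psi> j (\<alpha> i * x + \<beta> i * y))) = ct * (\<Sum>l=0..p. x ^ l * y ^ (p - l))"
    proof (cases "ct = 0")
      case True then show ?thesis using hom by simp
    next
      case False
      have "(\<Prod>j\<in>?P. if j \<in> B then \<psi> j x else \<psi> j y) = x ^ card B * y ^ (p - card B)" if "B \<in> Pow ?P" for B
      proof -
        have "(\<Prod>j\<in>?P. if j \<in> B then \<psi> j x else \<psi> j y) = (\<Prod>j\<in>?P. if j \<in> B then x else y)"
          using \<psi>_id[OF False] xy by (intro prod.cong refl) simp
        then show ?thesis using prod_if_const[of ?P B x y] that by simp
      qed
      then have "(\<Sum>B\<in>Pow ?P. S B * (\<Prod>j\<in>?P. if j \<in> B then \<psi> j x else \<psi> j y)) =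
          (\<Sum>B\<in>Pow ?P. ct / of_nat (p choose card B) * (x ^ card B * y ^ (p - card B)))"
        by (intro sum.cong refl) (simp add: S_div)
      \<comment> \<open>The number of subsets of size l cancels the binomial coefficient in the
        denominator.\<close>
      also have "\<dots> = (\<Sum>l=0..p. ct * (x ^ l * y ^ (p - l)))"
        by (subst sum_Pow_card) (auto intro!: sum.cong)
      finally show ?thesis by (simp add: expand sum_distrib_left)
    qed
  qed
  show ?thesis
  proof (rule exI[of _ K], rule exI[of _ \<phi>'], rule exI[of _ \<psi>],
      intro conjI exI[of _ ct] ballI allI impI)
    show "finitely_generated_subfield K" by (rule K_fg)
    show "\<phi>' \<in> S_star n a \<alpha> \<beta> p K" by (rule S_star)
    show "exponential_on (G_star p K) \<phi>'" by (rule exp)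
    show "\<psi> j \<in> ring_iso complex_field complex_field" if "j \<in> ?P" for j using \<psi>[OF that] .
    show "\<psi> j x = \<phi>' (\<lambda>k\<in>?P. if k = j then x else 1)" if "j \<in> ?P" "x \<in> K - {0}" for j x
    proof -
      have "(\<lambda>k\<in>?P. if k = j then x else 1) \<in> tuples p (K - {0})" using that K(1) by auto
      then show ?thesis using \<psi>_K[of j x] that by (simp add: \<phi>' e_def)
    qed
    show "\<phi>' x = (\<Prod>j=1..p. \<psi> j (x j))" if "x \<in> tuples p (K - {0})" for x
      unfolding \<phi>'[OF that] using that sub by (intro \<phi>_prod) blast
    show "\<alpha> i \<in> K" "\<beta> i \<in> K" if "i \<in> {1..n}" for i using \<alpha>\<beta>[OF that] .
    show "solves_on K n a \<alpha> \<beta> p ct (\<lambda>x. \<Prod>j=1..p. \<psi> j x)" by (rule solves)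
    show "(\<Sum>i=1..n. a i * of_nat (p choose l) *
        (\<Prod>j=1..l. \<psi> (\<sigma> j) (\<alpha> i)) * (\<Prod>j=l+1..p. \<psi> (\<sigma> j) (\<beta> i))) = ct"
      if "l \<in> {1..p-1}" "\<sigma> permutes ?P" for l \<sigma>
      using that by (intro sum_\<sigma>) auto
    show "(\<Sum>i=1..n. a i * (\<Prod>j=1..p. \<psi> j (\<alpha> i))) = ct" by (rule sum_\<alpha>)
    show "(\<Sum>i=1..n. a i * (\<Prod>j=1..p. \<psi> j (\<beta> i))) = ct" by (rule sum_\<beta>)
    show "(\<Sum>i=1..n. a i * (\<Prod>j=1..p. \<psi> j (\<alpha> i * x + \<beta> i * y))) = 0" if "ct = 0" for x y
      using that by (rule hom)
    show "\<psi> j x = x" if "ct \<noteq> 0" "j \<in> ?P" "x \<in> K" for j x using that by (rule \<psi>_id)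
    show "power_condition n a \<alpha> \<beta> p ct" if "ct \<noteq> 0" using that by (rule pc)
  qed
qed

theorem theorem4p1:
  fixes n p :: nat and a \<alpha> \<beta> :: "nat \<Rightarrow> complex" and c :: complex
  assumes sum_nz: "\<And>i. i \<in> {1..n} \<Longrightarrow> \<alpha> i + \<beta> i \<noteq> 0"
    and det_nz: "\<And>i j. i \<in> {1..n} \<Longrightarrow> j \<in> {1..n} \<Longrightarrow> i \<noteq> j \<Longrightarrow> \<alpha> i * \<beta> j - \<alpha> j * \<beta> i \<noteq> 0"
    and p_gt: "p > 1"
  shows
    "((\<exists>f. generalized_monomial p f \<and> f \<noteq> (\<lambda>x. 0) \<and> solves_on UNIV n a \<alpha> \<beta> p c f) \<longrightarrow>
      (\<exists>K \<phi> \<psi>.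
         finitely_generated_subfield K \<and> (\<forall>i\<in>{1..n}. \<alpha> i \<in> K \<and> \<beta> i \<in> K) \<and>
         \<phi> \<in> S_star n a \<alpha> \<beta> p K \<and> exponential_on (G_star p K) \<phi> \<and>
         (\<forall>j\<in>{1..p}. \<psi> j \<in> ring_iso complex_field complex_field) \<and>
         (\<forall>j\<in>{1..p}. \<forall>x\<in>K - {0}. \<psi> j x = \<phi> (\<lambda>k\<in>{1..p}. if k = j then x else 1)) \<and>
         (\<forall>x\<in>tuples p (K - {0}). \<phi> x = (\<Prod>j=1..p. \<psi> j (x j))) \<and>
         (\<exists>ct.
            solves_on K n a \<alpha> \<beta> p ct (\<lambda>x. \<Prod>j=1..p. \<psi> j x) \<and>
            (\<Sum>i=1..n. a i * (\<Prod>j=1..p. \<psi> j (\<alpha> i))) = ct \<and>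
            (\<Sum>i=1..n. a i * (\<Prod>j=1..p. \<psi> j (\<beta> i))) = ct \<and>
            (\<forall>l\<in>{1..p-1}. \<forall>\<sigma>. \<sigma> permutes {1..p} \<longrightarrow>
               (\<Sum>i=1..n. a i * of_nat (p choose l) *
                  (\<Prod>j=1..l. \<psi> (\<sigma> j) (\<alpha> i)) * (\<Prod>j=l+1..p. \<psi> (\<sigma> j) (\<beta> i))) = ct) \<and>
            (ct = 0 \<longrightarrow>
               (\<forall>x y. (\<Sum>i=1..n. a i * (\<Prod>j=1..p. \<psi> j (\<alpha> i * x + \<beta> i * y))) = 0)) \<and>
            (ct \<noteq> 0 \<longrightarrow>
               (\<forall>j\<in>{1..p}. \<forall>x\<in>K. \<psi> j x = x) \<and> power_condition n a \<alpha> \<beta> p ct)))) \<and>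
     (\<forall>ct. c \<noteq> 0 \<longrightarrow> power_condition n a \<alpha> \<beta> p ct \<longrightarrow>
        generalized_monomial p (\<lambda>x. c / ct * x ^ p) \<and>
        (\<lambda>x. c / ct * x ^ p) \<noteq> (\<lambda>x. 0) \<and>
        solves_on UNIV n a \<alpha> \<beta> p c (\<lambda>x. c / ct * x ^ p))"
  by (rule conjI; intro impI allI; (elim exE conjE)?;
      (rule spectral_solution | rule power_solution); assumption)

end
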